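(* Let $g:\mathbb{R}\to[0,\infty)$ be a measurable function such that $g>0$ on some neighbourhood of $0$. Suppose that $\xi=(\xi_t)_{t\geq0}$ is a non-zero transient real-valued Lévy process such that $0$ is regular for itself, i.e. $\inf\{t>0:\xi_t=0\}=0$ almost surely, and that the integral $I:=\int_0^\infty g(\xi_t)\,dt$ is finite almost surely. Then the distribution of $I$ has no atoms.
   Context: A Lévy process is transient if $|\xi_t|\to\infty$ almost surely as $t\to\infty$. $\int_0^\infty$ denotes the almost sure limit of $\int_0^t$ as $t\to\infty$. *)

theory Defs
  imports "HOL-Probability.Probability"
begin

definition cadlag_path :: "(real \<Rightarrow> real) \<Rightarrow> bool" where
  "cadlag_path f \<longleftrightarrow>
     (\<forall>t\<ge>0. continuous (at_right t) f \<and> (t > 0 \<longrightarrow> (\<exists>l. (f \<longlongrightarrow> l) (at_left t))))"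

definition levy_process :: "'a measure \<Rightarrow> (real \<Rightarrow> 'a \<Rightarrow> real) \<Rightarrow> bool" where
  "levy_process M X \<longleftrightarrow>
     prob_space M \<and>
     (\<forall>t\<ge>0. X t \<in> borel_measurable M) \<and>
     (AE \<omega> in M. X 0 \<omega> = 0) \<and>
     (\<forall>(n::nat) (s::nat \<Rightarrow> real). 0 \<le> s 0 \<and> strict_mono s \<longrightarrow>
        prob_space.indep_vars M (\<lambda>_. borel) (\<lambda>i \<omega>. X (s (Suc i)) \<omega> - X (s i) \<omega>) {..<n}) \<and>
     (\<forall>s\<ge>0. \<forall>t\<ge>0. distr M borel (\<lambda>\<omega>. X (s + t) \<omega> - X s \<omega>) = distr M borel (X t)) \<and>
     (AE \<omega> in M. cadlag_path (\<lambda>t. X t \<omega>))"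

definition transient_process :: "'a measure \<Rightarrow> (real \<Rightarrow> 'a \<Rightarrow> real) \<Rightarrow> bool" where
  "transient_process M X \<longleftrightarrow> (AE \<omega> in M. filterlim (\<lambda>t. \<bar>X t \<omega>\<bar>) at_top at_top)"

text \<open>0 is regular for itself: inf {t > 0. X t = 0} = 0 a.s. (inf of the empty set = +\<infinity>).\<close>
definition zero_regular_for_itself :: "'a measure \<Rightarrow> (real \<Rightarrow> 'a \<Rightarrow> real) \<Rightarrow> bool" where
  "zero_regular_for_itself M X \<longleftrightarrow>
     (AE \<omega> in M. Inf (ereal ` {t. t > 0 \<and> X t \<omega> = 0}) = 0)"

text \<open>The perpetual integral int_0^\<infinity> g(X t) dt (pathwise, for nonnegative g); by monotone
  convergence this is the limit of int_0^T as T \<rightarrow> \<infinity>.\<close>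
definition perpetual_integral :: "(real \<Rightarrow> real) \<Rightarrow> (real \<Rightarrow> 'a \<Rightarrow> real) \<Rightarrow> 'a \<Rightarrow> ennreal" where
  "perpetual_integral g X \<omega> = (\<integral>\<^sup>+ t \<in> {0..}. ennreal (g (X t \<omega>)) \<partial>lborel)"

end

theory Submission
  imports Defs
begin

text \<open>Let \<open>T\<close> be the first zero of \<open>\<xi>\<close> after time \<open>\<delta>\<close>, and \<open>A\<close> the integral of \<open>g(\<xi>)\<close> over
  \<open>[0, T)\<close>. Then \<open>I = A + I'\<close>, where \<open>I'\<close> is the perpetual integral of the restarted process and
  is distributed as \<open>I\<close>, and \<open>A > 0\<close> because \<open>g > 0\<close> near \<open>0\<close>. Hence \<open>I = c\<close> and \<open>A \<le> \<eta>\<close> force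
  \<open>c - \<eta> \<le> I' < c\<close>, so that for every \<open>K\<close>
  \<open>P(I = c) \<le> P(T \<ge> K) + P(\<integral>\<^sub>0\<^sup>K g(\<xi>) dt > \<eta>) + P(c - \<eta> \<le> I < c)\<close>.
  The three terms vanish on letting \<open>\<delta> \<rightarrow> 0\<close> (regularity), then \<open>K \<rightarrow> 0\<close> (\<open>I < \<infinity>\<close>), then \<open>\<eta> \<rightarrow> 0\<close>.

  To avoid measurability problems, \<open>T\<close> is replaced by the limit of the entry times into \<open>(-1/n, 1/n)\<close>, each of
  which is a limit of entry times along dyadic grids, where the restarted process has the right law
  by the independence of the increments.\<close>

section \<open>Entry times of cadlag paths\<close>

definition dyadic_above :: "nat \<Rightarrow> real \<Rightarrow> nat" where
  "dyadic_above p t = nat \<lfloor>2 ^ p * t\<rfloor> + 1"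

text \<open>The \<open>+ 1\<close> in \<open>dyadic_above\<close> keeps the lower bound strict even
  when \<open>t\<close> is itself dyadic. Strictness matters in \<open>restart_limit\<close>, which
  controls the limiting path only along times \<open>a n > s\<close>.\<close>

lemma dyadic_above_bounds:
  assumes "0 \<le> t"
  shows "t < real (dyadic_above p t) / 2 ^ p" "real (dyadic_above p t) / 2 ^ p \<le> t + (1/2) ^ p"
proof -
  have "0 \<le> \<lfloor>2 ^ p * t\<rfloor>" using assms by simp
  then have e: "real (dyadic_above p t) = of_int \<lfloor>2 ^ p * t\<rfloor> + 1"
    by (simp add: dyadic_above_def)
  have "2 ^ p * t < real (dyadic_above p t)" "real (dyadic_above p t) \<le> 2 ^ p * t + 1"
    unfolding e by linarith+
  then show "t < real (dyadic_above p t) / 2 ^ p" "real (dyadic_above p t) / 2 ^ p \<le> t + (1/2) ^ p"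
    by (auto simp: field_simps power_divide)
qed

lemma dyadic_above_tendsto:
  assumes "0 \<le> t"
  shows "(\<lambda>p. real (dyadic_above p t) / 2 ^ p) \<longlonglongrightarrow> t"
proof (rule tendsto_sandwich)
  show "\<forall>\<^sub>F p in sequentially. t \<le> real (dyadic_above p t) / 2 ^ p"
    using dyadic_above_bounds(1)[OF assms] by (simp add: less_imp_le)
  show "\<forall>\<^sub>F p in sequentially. real (dyadic_above p t) / 2 ^ p \<le> t + (1/2) ^ p"
    using dyadic_above_bounds(2)[OF assms] by simp
  have "(\<lambda>p. t + (1/2::real) ^ p) \<longlonglongrightarrow> t + 0"
    by (intro tendsto_intros LIMSEQ_realpow_zero) auto
  then show "(\<lambda>p. t + (1/2::real) ^ p) \<longlonglongrightarrow> t" by simp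
qed simp

lemma right_continuous_tendsto:
  fixes x :: "real \<Rightarrow> real"
  assumes "continuous (at_right t) x" "\<forall>\<^sub>F n in F. t \<le> a n" "(a \<longlongrightarrow> t) F"
  shows "((\<lambda>n. x (a n)) \<longlongrightarrow> x t) F"
proof (rule continuous_within_tendsto_compose[where S = "{t..}" and f = x and x = a])
  show "continuous (at t within {t..}) x" using assms(1) by (simp add: at_within_Ici_at_right)
qed (use assms in auto)

section \<open>Entry times into a neighbourhood of 0 and their grid versions\<close>

definition hits :: "real \<Rightarrow> real \<Rightarrow> real \<Rightarrow> nat \<Rightarrow> (real \<Rightarrow> real) \<Rightarrow> nat \<Rightarrow> bool" where
  "hits \<delta> K e m x k \<longleftrightarrow> \<delta> \<le> real k / 2 ^ m \<and> real k / 2 ^ m < K \<and> \<bar>x (real k / 2 ^ m)\<bar> < e"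

text \<open>Without a hit the \<open>LEAST\<close> is unspecified. Bounds on this time are therefore
  stated for large \<open>m\<close> only, and expectations carry the indicator of
  \<open>visits\<close>.\<close>

definition grid_time :: "real \<Rightarrow> real \<Rightarrow> real \<Rightarrow> nat \<Rightarrow> (real \<Rightarrow> real) \<Rightarrow> real" where
  "grid_time \<delta> K e m x = real (LEAST k. hits \<delta> K e m x k) / 2 ^ m"

definition entry_time :: "real \<Rightarrow> real \<Rightarrow> (real \<Rightarrow> real) \<Rightarrow> real" where
  "entry_time \<delta> e x = Inf {t. \<delta> \<le> t \<and> \<bar>x t\<bar> < e}"

lemma entry_time_le: "\<delta> \<le> t \<Longrightarrow> \<bar>x t\<bar> < e \<Longrightarrow> entry_time \<delta> e x \<le> t"
  unfolding entry_time_def by (rule cInf_lower) (auto intro: bdd_belowI[of _ \<delta>])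

lemma entry_time_ge: "\<delta> \<le> t \<Longrightarrow> \<bar>x t\<bar> < e \<Longrightarrow> \<delta> \<le> entry_time \<delta> e x"
  unfolding entry_time_def by (rule cInf_greatest) auto

text \<open>The condition \<open>\<bar>x t\<bar> < e\<close> is open, so right continuity passes it
  from a time \<open>t\<close> of the entry set, chosen below both \<open>c\<close> and
  \<open>K\<close>, to the dyadics just to the right of \<open>t\<close>.\<close>

lemma eventually_hits:
  assumes rc: "\<forall>t\<ge>0. continuous (at_right t) x" and "0 \<le> \<delta>"
    and ex: "\<delta> \<le> t0" "t0 < K" "\<bar>x t0\<bar> < e" and c: "entry_time \<delta> e x < c"
  shows "\<forall>\<^sub>F m in sequentially. \<exists>k. hits \<delta> K e m x k \<and> real k / 2 ^ m < c"
proof -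
  have "entry_time \<delta> e x < min c K"
    using c entry_time_le[OF ex(1), of x e] ex by linarith
  then obtain t where t: "\<delta> \<le> t" "\<bar>x t\<bar> < e" "t < c" "t < K"
    unfolding entry_time_def
    by (subst (asm) cInf_less_iff) (use ex in \<open>auto intro: bdd_belowI[of _ \<delta>]\<close>)
  have t0: "0 \<le> t" using t assms by simp
  have "(\<lambda>p. x (real (dyadic_above p t) / 2 ^ p)) \<longlonglongrightarrow> x t"
    using dyadic_above_bounds(1)[OF t0] rc t0
    by (intro right_continuous_tendsto[OF _ _ dyadic_above_tendsto]) (auto simp: less_imp_le)
  then have "(\<lambda>p. \<bar>x (real (dyadic_above p t) / 2 ^ p)\<bar>) \<longlonglongrightarrow> \<bar>x t\<bar>"
    by (rule tendsto_rabs)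
  then have "\<forall>\<^sub>F p in sequentially. \<bar>x (real (dyadic_above p t) / 2 ^ p)\<bar> < e"
    using t by (auto dest: order_tendstoD)
  moreover have "\<forall>\<^sub>F p in sequentially. real (dyadic_above p t) / 2 ^ p < c"
    "\<forall>\<^sub>F p in sequentially. real (dyadic_above p t) / 2 ^ p < K"
    using dyadic_above_tendsto[OF t0] t by (auto dest: order_tendstoD)
  ultimately show ?thesis
  proof eventually_elim
    case (elim p)
    then show ?case using dyadic_above_bounds(1)[OF t0, of p] t
      by (intro exI[of _ "dyadic_above p t"]) (auto simp: hits_def)
  qed
qed

text \<open>A grid hit belongs to the entry set, which gives the lower bound. For every
  \<open>c\<close> beyond the entry time, \<open>eventually_hits\<close> supplies a hit before
  \<open>c\<close>, and the least hit is no later.\<close>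

lemma
  assumes rc: "\<forall>t\<ge>0. continuous (at_right t) x" and "0 \<le> \<delta>"
    and ex: "\<delta> \<le> t0" "t0 < K" "\<bar>x t0\<bar> < e"
  shows entry_time_le_grid_time: "\<forall>\<^sub>F m in sequentially. entry_time \<delta> e x \<le> grid_time \<delta> K e m x"
    and grid_time_tendsto: "(\<lambda>m. grid_time \<delta> K e m x) \<longlonglongrightarrow> entry_time \<delta> e x"
proof -
  have up: "\<forall>\<^sub>F m in sequentially. entry_time \<delta> e x \<le> grid_time \<delta> K e m x \<and> grid_time \<delta> K e m x < c"
    if c: "entry_time \<delta> e x < c" for c
    using eventually_hits[OF rc assms(2) ex c]
  proof eventually_elim
    case (elim m)
    then obtain k where k: "hits \<delta> K e m x k" "real k / 2 ^ m < c" by auto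
    let ?l = "LEAST k. hits \<delta> K e m x k"
    have "hits \<delta> K e m x ?l" "?l \<le> k" using k by (auto intro: LeastI Least_le)
    then have "entry_time \<delta> e x \<le> grid_time \<delta> K e m x"
      unfolding grid_time_def hits_def by (auto intro: entry_time_le)
    moreover have "grid_time \<delta> K e m x \<le> real k / 2 ^ m"
      unfolding grid_time_def using \<open>?l \<le> k\<close> by (intro divide_right_mono) auto
    ultimately show ?case using k by auto
  qed
  show "\<forall>\<^sub>F m in sequentially. entry_time \<delta> e x \<le> grid_time \<delta> K e m x"
    using up[of "entry_time \<delta> e x + 1"] by (auto elim: eventually_mono)
  show "(\<lambda>m. grid_time \<delta> K e m x) \<longlonglongrightarrow> entry_time \<delta> e x"
  proof (rule order_tendstoI)
    fix a assume "a < entry_time \<delta> e x"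
    then show "\<forall>\<^sub>F m in sequentially. a < grid_time \<delta> K e m x"
      using up[of "entry_time \<delta> e x + 1"] by (auto elim!: eventually_mono)
  next
    fix a assume "entry_time \<delta> e x < a"
    from up[OF this] show "\<forall>\<^sub>F m in sequentially. grid_time \<delta> K e m x < a"
      by (auto elim!: eventually_mono)
  qed
qed

text \<open>The infimum need not be attained; the strict bound at the grid times survives the limit
  from the right only as \<open>\<le> e\<close>.\<close>

lemma abs_entry_time_le:
  assumes rc: "\<forall>t\<ge>0. continuous (at_right t) x" and "0 \<le> \<delta>"
    and ex: "\<delta> \<le> t0" "\<bar>x t0\<bar> < e"
  shows "\<bar>x (entry_time \<delta> e x)\<bar> \<le> e"
proof -
  define K where "K = t0 + 1"
  have K: "t0 < K" by (simp add: K_def)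
  note * = rc assms(2) ex(1) K ex(2)
  have "0 \<le> entry_time \<delta> e x" using entry_time_ge[of \<delta> t0 x e] ex assms(2) by simp
  then have "(\<lambda>m. x (grid_time \<delta> K e m x)) \<longlonglongrightarrow> x (entry_time \<delta> e x)"
    using rc entry_time_le_grid_time[OF *]
    by (intro right_continuous_tendsto[OF _ _ grid_time_tendsto[OF *]]) auto
  then have lim: "(\<lambda>m. \<bar>x (grid_time \<delta> K e m x)\<bar>) \<longlonglongrightarrow> \<bar>x (entry_time \<delta> e x)\<bar>"
    by (rule tendsto_rabs)
  have "entry_time \<delta> e x < K" using entry_time_le[of \<delta> t0 x e] ex K by simp
  from eventually_hits[OF * this]
  have "\<forall>\<^sub>F m in sequentially. \<bar>x (grid_time \<delta> K e m x)\<bar> \<le> e"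
  proof eventually_elim
    case (elim m)
    then have "hits \<delta> K e m x (LEAST k. hits \<delta> K e m x k)" by (auto intro: LeastI)
    then show ?case by (simp add: hits_def grid_time_def)
  qed
  then show ?thesis by (intro tendsto_upperbound[OF lim]) auto
qed

text \<open>If the entry times into shrinking neighbourhoods of \<open>0\<close> increase strictly to \<open>T\<close>, the
  restarted path converges to the left limits \<open>x ((T + d)-)\<close>; its right limits are still
  \<open>x (T + s)\<close>, so no quasi-left continuity is needed.\<close>

lemma restart_limit:
  assumes x: "cadlag_path x" and \<delta>: "0 \<le> \<delta>" and e: "decseq e" "e \<longlonglongrightarrow> 0"
    and ex: "\<And>n. \<exists>t. \<delta> \<le> t \<and> t < K \<and> \<bar>x t\<bar> < e n"
  obtains T y where "\<delta> \<le> T" "T \<le> K"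
    "\<And>d. 0 \<le> d \<Longrightarrow> (\<lambda>n. x (entry_time \<delta> (e n) x + d) - x (entry_time \<delta> (e n) x)) \<longlonglongrightarrow> y d"
    "\<And>s a. 0 \<le> s \<Longrightarrow> a \<longlonglongrightarrow> s \<Longrightarrow> (\<And>n. s < a n) \<Longrightarrow> (\<lambda>n. y (a n)) \<longlonglongrightarrow> x (T + s)"
proof -
  have rc: "\<forall>t\<ge>0. continuous (at_right t) x"
    using x by (auto simp: cadlag_path_def)
  define \<tau> where "\<tau> n = entry_time \<delta> (e n) x" for n
  have ge: "\<delta> \<le> \<tau> n" and le: "\<tau> n \<le> K" and xe: "\<bar>x (\<tau> n)\<bar> \<le> e n" for n
  proof -
    from ex[of n] obtain t where t: "\<delta> \<le> t" "t < K" "\<bar>x t\<bar> < e n" by auto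
    show "\<delta> \<le> \<tau> n" using entry_time_ge[of \<delta> t x "e n"] t by (simp add: \<tau>_def)
    show "\<tau> n \<le> K" using entry_time_le[of \<delta> t x "e n"] t by (simp add: \<tau>_def)
    show "\<bar>x (\<tau> n)\<bar> \<le> e n" using abs_entry_time_le[OF rc \<delta> t(1,3)] by (simp add: \<tau>_def)
  qed
  have "incseq \<tau>"
  proof (rule incseq_SucI)
    fix n
    show "\<tau> n \<le> \<tau> (Suc n)" unfolding \<tau>_def entry_time_def
      using ex[of "Suc n"] decseq_SucD[OF e(1), of n]
      by (intro cInf_superset_mono) (auto intro: bdd_belowI[of _ \<delta>])
  qed
  then obtain T where T: "\<tau> \<longlonglongrightarrow> T" "\<And>n. \<tau> n \<le> T" using incseq_convergent[of \<tau> K] le by auto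
  have T': "\<delta> \<le> T" "T \<le> K" using T(2)[of 0] ge[of 0] LIMSEQ_le_const2[OF T(1)] le by auto
  have x0: "(\<lambda>n. x (\<tau> n)) \<longlonglongrightarrow> 0"
    by (rule Lim_null_comparison[OF _ e(2)]) (use xe in auto)
  show thesis
  proof (cases "\<exists>n. \<tau> n = T")
    \<comment> \<open>The increasing entry times are eventually constant, so \<open>x T = 0\<close>
      by uniqueness of limits, and the limit path is simply \<open>x (T + d)\<close>.\<close>
    case True
    then obtain n0 where n0: "\<tau> n0 = T" by auto
    have ev: "\<forall>\<^sub>F n in sequentially. \<tau> n = T"
      using n0 T(2) incseqD[OF \<open>incseq \<tau>\<close>]
      by (auto simp: eventually_sequentially intro!: exI[of _ n0] antisym)
    have xT: "x T = 0"
      by (rule LIMSEQ_unique[OF _ x0], rule tendsto_eventually) (use ev in eventually_elim, simp)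
    show thesis
    proof (rule that[of T "\<lambda>d. x (T + d)"])
      fix d :: real assume "0 \<le> d"
      show "(\<lambda>n. x (entry_time \<delta> (e n) x + d) - x (entry_time \<delta> (e n) x)) \<longlonglongrightarrow> x (T + d)"
        unfolding \<tau>_def[symmetric]
        by (rule tendsto_eventually) (use ev in eventually_elim, simp add: xT)
    next
      fix s :: real and a :: "nat \<Rightarrow> real" assume s: "0 \<le> s" and a: "a \<longlonglongrightarrow> s" "\<And>n. s < a n"
      have "(\<lambda>n. T + a n) \<longlonglongrightarrow> T + s" by (intro tendsto_intros a)
      then show "(\<lambda>n. x (T + a n)) \<longlonglongrightarrow> x (T + s)"
        by (rule right_continuous_tendsto[rotated 2]) (use \<delta> T' s a(2) rc in \<open>auto simp: less_imp_le\<close>)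
    qed (use T' in auto)
  next
    case False
    then have less: "\<tau> n < T" for n using T(2)[of n] by (auto simp: less_le)
    \<comment> \<open>A cadlag path has left limits at positive times only. Approaching
      \<open>T\<close> strictly from below makes \<open>T\<close> positive even for
      \<open>\<delta> = 0\<close>.\<close>
    have "0 < T" using less[of 0] ge[of 0] \<delta> by simp
    then have "\<exists>l. (x \<longlongrightarrow> l) (at_left (T + d))" if "0 \<le> d" for d
      using x that by (auto simp: cadlag_path_def)
    then obtain y where y: "\<And>d. 0 \<le> d \<Longrightarrow> (x \<longlongrightarrow> y d) (at_left (T + d))" by metis
    show thesis
    proof (rule that[of T y])
      fix d :: real assume d: "0 \<le> d"
      have "filterlim (\<lambda>n. \<tau> n + d) (at_left (T + d)) sequentially"
        unfolding filterlim_at using less less_imp_neq[OF less]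
        by (auto intro!: tendsto_intros T always_eventually)
      then have "(\<lambda>n. x (\<tau> n + d) - x (\<tau> n)) \<longlonglongrightarrow> y d - 0"
        by (intro tendsto_diff x0 filterlim_compose[OF y[OF d]])
      then show "(\<lambda>n. x (entry_time \<delta> (e n) x + d) - x (entry_time \<delta> (e n) x)) \<longlonglongrightarrow> y d"
        by (simp add: \<tau>_def)
    next
      fix s :: real and a :: "nat \<Rightarrow> real" assume s: "0 \<le> s" and a: "a \<longlonglongrightarrow> s" "\<And>n. s < a n"
      have "(x \<longlongrightarrow> x (T + s)) (at_right (T + s))"
        using rc \<open>0 < T\<close> s by (simp add: continuous_within)
      show "(\<lambda>n. y (a n)) \<longlonglongrightarrow> x (T + s)"
      proof (rule metric_LIMSEQ_I)
        fix r :: real assume "0 < r"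
        then have "\<forall>\<^sub>F u in at_right (T + s). dist (x u) (x (T + s)) < r / 2"
          using \<open>(x \<longlongrightarrow> x (T + s)) (at_right (T + s))\<close> by (intro tendstoD) auto
        then obtain b where b: "b > T + s" "\<And>u. T + s < u \<Longrightarrow> u < b \<Longrightarrow> dist (x u) (x (T + s)) < r / 2"
          unfolding eventually_at_right_field by auto
        \<comment> \<open>\<open>y v\<close> is the left limit at \<open>T + v\<close>, hence a
          limit of values \<open>x u\<close> with \<open>T + s < u < T + v\<close>, all of them
          within \<open>r / 2\<close> of \<open>x (T + s)\<close>.\<close>
        have near: "dist (y v) (x (T + s)) < r" if v: "s < v" "v < b - T" for v
        proof -
          have "\<forall>\<^sub>F u in at_left (T + v). u \<in> {T + s<..<T + v}"
            using v by (intro eventually_at_left_real) auto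
          then have "\<forall>\<^sub>F u in at_left (T + v). dist (x u) (x (T + s)) \<le> r / 2"
            by eventually_elim (use b(2) v in \<open>force intro: less_imp_le\<close>)
          then have "dist (y v) (x (T + s)) \<le> r / 2"
            using v s by (intro tendsto_upperbound[OF tendsto_dist[OF y tendsto_const]]) auto
          then show ?thesis using \<open>0 < r\<close> by simp
        qed
        have "\<forall>\<^sub>F n in sequentially. a n < b - T" using order_tendstoD(2)[OF a(1), of "b - T"] b(1) by simp
        then show "\<exists>n0. \<forall>n\<ge>n0. dist (y (a n)) (x (T + s)) < r"
          using near a(2) by (force simp: eventually_sequentially)
      qed
    qed (use T' in auto)
  qed
qed

section \<open>Restarting at grid times\<close>

definition dyadic :: "nat \<times> nat \<Rightarrow> real" where
  "dyadic d = real (snd d) / 2 ^ fst d"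

lemma dyadic_nonneg [simp]: "0 \<le> dyadic d"
  by (simp add: dyadic_def)

text \<open>Lets finitely many dyadics of different levels be read on one common grid.\<close>

lemma dyadic_eq_grid: "fst d \<le> m \<Longrightarrow> dyadic d = real (snd d * 2 ^ (m - fst d)) / 2 ^ m"
  by (simp add: dyadic_def field_simps power_add[symmetric])

text \<open>The start is 0 everywhere, not only almost surely, so that grid values are partial sums
  of steps for every single \<open>\<omega>\<close>.\<close>

locale based_levy_process = prob_space M for M :: "'a measure" +
  fixes W :: "real \<Rightarrow> 'a \<Rightarrow> real"
  assumes levy: "levy_process M W" and start [simp]: "W 0 \<omega> = 0"
begin

abbreviation path :: "'a \<Rightarrow> real \<Rightarrow> real" where
  "path \<omega> \<equiv> (\<lambda>t. W t \<omega>)"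

lemma measurable_W [measurable (raw)]: "0 \<le> t \<Longrightarrow> W t \<in> borel_measurable M"
  using levy by (auto simp: levy_process_def)

section \<open>Increments along a dyadic grid\<close>

definition step :: "nat \<Rightarrow> nat \<Rightarrow> 'a \<Rightarrow> real" where
  "step m i \<omega> = W (real (Suc i) / 2 ^ m) \<omega> - W (real i / 2 ^ m) \<omega>"

lemma measurable_step [measurable]: "step m i \<in> borel_measurable M"
  unfolding step_def by measurable

lemma sum_step: "(\<Sum>l<j. step m (i + l) \<omega>) = W (real (i + j) / 2 ^ m) \<omega> - W (real i / 2 ^ m) \<omega>"
  using sum_lessThan_telescope[of "\<lambda>l. W (real (i + l) / 2 ^ m) \<omega>" j] by (simp add: step_def)

lemma indep_step: "indep_vars (\<lambda>_. borel) (\<lambda>i. step m (k + i)) {..<n}"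
proof -
  define s where "s i = real (k + i) / 2 ^ m" for i
  have "strict_mono s" "0 \<le> s 0"
    by (auto simp: s_def strict_mono_def divide_strict_right_mono)
  then have "indep_vars (\<lambda>_. borel) (\<lambda>i \<omega>. W (s (Suc i)) \<omega> - W (s i) \<omega>) {..<n}"
    using levy by (auto simp: levy_process_def)
  moreover have "(\<lambda>i \<omega>. W (s (Suc i)) \<omega> - W (s i) \<omega>) = (\<lambda>i. step m (k + i))"
    by (simp add: step_def s_def fun_eq_iff)
  ultimately show ?thesis by simp
qed

lemma distr_step: "distr M borel (step m i) = distr M borel (W (1 / 2 ^ m))"
proof -
  have "step m i = (\<lambda>\<omega>. W (real i / 2 ^ m + 1 / 2 ^ m) \<omega> - W (real i / 2 ^ m) \<omega>)"
    by (simp add: step_def fun_eq_iff add_divide_distrib add.commute)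
  then show ?thesis using levy by (auto simp: levy_process_def)
qed

text \<open>The right-hand side does not depend on \<open>k\<close>: a block of steps may be moved
  to the origin without changing its joint law.\<close>

lemma distr_steps:
  "distr M (PiM {..<r} (\<lambda>_. borel)) (\<lambda>\<omega>. \<lambda>i\<in>{..<r}. step m (k + i) \<omega>) =
   PiM {..<r} (\<lambda>_. distr M borel (W (1 / 2 ^ m)))"
\<comment> \<open>The product-law form of independence is for nonempty index sets. For
  \<open>r = 0\<close> both sides are probability measures on a one-point space.\<close>
proof (cases "r = 0")
  case True
  interpret D: prob_space "distr M (PiM {..<r} (\<lambda>_. borel)) (\<lambda>\<omega>. \<lambda>i\<in>{..<r}. step m (k + i) \<omega>)"
    by (rule prob_space_distr) measurable
  show ?thesis
    by (rule measure_eqI_finite[where A = "{\<lambda>_. undefined}"])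
      (use True D.emeasure_space_1 in \<open>auto simp: PiM_empty space_PiM emeasure_distr emeasure_space_1\<close>)
next
  case False
  then have "distr M (PiM {..<r} (\<lambda>_. borel)) (\<lambda>\<omega>. \<lambda>i\<in>{..<r}. step m (k + i) \<omega>) =
      PiM {..<r} (\<lambda>i. distr M borel (step m (k + i)))"
    by (subst indep_vars_iff_distr_eq_PiM'[symmetric]) (auto intro: indep_step)
  then show ?thesis by (simp add: distr_step)
qed

text \<open>The Markov property at a deterministic grid time: steps before \<open>k\<close> and from
  \<open>k\<close> on form disjoint, hence independent, blocks, and \<open>distr_steps\<close>
  shifts the later block to the origin.\<close>

lemma expectation_past_times_future:
  fixes h :: "(nat \<Rightarrow> real) \<Rightarrow> real"
  assumes A [measurable]: "A \<in> sets (PiM {..<k} (\<lambda>_. borel))"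
    and h [measurable]: "h \<in> borel_measurable (PiM {..<r} (\<lambda>_. borel))"
    and bdd: "\<And>z. \<bar>h z\<bar> \<le> 1"
  shows "(\<integral>\<omega>. indicator A (\<lambda>i\<in>{..<k}. step m i \<omega>) * h (\<lambda>i\<in>{..<r}. step m (k + i) \<omega>) \<partial>M) =
    (\<integral>\<omega>. indicator A (\<lambda>i\<in>{..<k}. step m i \<omega>) \<partial>M) * (\<integral>\<omega>. h (\<lambda>i\<in>{..<r}. step m i \<omega>) \<partial>M)"
proof -
  let ?B = "{k..<k + r}"
  have "indep_vars (\<lambda>_. borel) (step m) {..<k + r}"
    using indep_step[of m 0] by simp
  then have "indep_var (PiM {..<k} (\<lambda>_. borel)) (\<lambda>\<omega>. \<lambda>i\<in>{..<k}. step m i \<omega>)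
      (PiM ?B (\<lambda>_. borel)) (\<lambda>\<omega>. \<lambda>i\<in>?B. step m i \<omega>)"
    by (rule indep_var_restrict) auto
  \<comment> \<open>Independence gives the future block with indices in \<open>?B\<close>;
    \<open>h\<close> expects them to start at 0, so it is composed with the shift by
    \<open>k\<close>.\<close>
  moreover have "(\<lambda>z. h (\<lambda>i\<in>{..<r}. z (k + i))) \<in> borel_measurable (PiM ?B (\<lambda>_. borel))"
    by (rule measurable_compose[OF measurable_restrict h]) measurable
  ultimately have "indep_var borel (indicator A \<circ> (\<lambda>\<omega>. \<lambda>i\<in>{..<k}. step m i \<omega>) :: 'a \<Rightarrow> real)
      borel ((\<lambda>z. h (\<lambda>i\<in>{..<r}. z (k + i))) \<circ> (\<lambda>\<omega>. \<lambda>i\<in>?B. step m i \<omega>))"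
    by (intro indep_var_compose) auto
  moreover have "(\<lambda>z. h (\<lambda>i\<in>{..<r}. z (k + i))) \<circ> (\<lambda>\<omega>. \<lambda>i\<in>?B. step m i \<omega>) =
      (\<lambda>\<omega>. h (\<lambda>i\<in>{..<r}. step m (k + i) \<omega>))"
    by (auto simp: fun_eq_iff intro!: arg_cong[where f = h] restrict_ext)
  ultimately have ind: "indep_var borel (\<lambda>\<omega>. indicator A (\<lambda>i\<in>{..<k}. step m i \<omega>) :: real)
      borel (\<lambda>\<omega>. h (\<lambda>i\<in>{..<r}. step m (k + i) \<omega>))"
    by (simp add: comp_def)
  have int: "integrable M (\<lambda>\<omega>. h (\<lambda>i\<in>{..<r}. step m (k + i) \<omega>))"
    using bdd by (intro integrable_const_bound[where B = 1]) auto
  have "(\<integral>\<omega>. h (\<lambda>i\<in>{..<r}. step m (k + i) \<omega>) \<partial>M) = (\<integral>\<omega>. h (\<lambda>i\<in>{..<r}. step m (0 + i) \<omega>) \<partial>M)"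
    using integral_distr[of "\<lambda>\<omega>. \<lambda>i\<in>{..<r}. step m (k + i) \<omega>" M "PiM {..<r} (\<lambda>_. borel)" h]
      integral_distr[of "\<lambda>\<omega>. \<lambda>i\<in>{..<r}. step m (0 + i) \<omega>" M "PiM {..<r} (\<lambda>_. borel)" h]
    unfolding distr_steps by simp
  then show ?thesis
    by (subst indep_var_lebesgue_integral[OF ind _ int])
      (auto intro!: integrable_const_bound[where B = 1])
qed

section \<open>The process after the first grid visit\<close>

lemma measurable_hits [measurable]: "Measurable.pred M (\<lambda>\<omega>. hits \<delta> K e m (path \<omega>) k)"
  unfolding hits_def by measurable

definition visits :: "real \<Rightarrow> real \<Rightarrow> real \<Rightarrow> nat \<Rightarrow> 'a \<Rightarrow> bool" where
  "visits \<delta> K e m \<omega> \<longleftrightarrow> (\<exists>k. hits \<delta> K e m (path \<omega>) k)"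

lemma measurable_visits [measurable]: "Measurable.pred M (visits \<delta> K e m)"
  unfolding visits_def by measurable

definition restart :: "real \<Rightarrow> real \<Rightarrow> real \<Rightarrow> nat \<Rightarrow> nat \<times> nat \<Rightarrow> 'a \<Rightarrow> real" where
  "restart \<delta> K e m d \<omega> =
    W (grid_time \<delta> K e m (path \<omega>) + dyadic d) \<omega> - W (grid_time \<delta> K e m (path \<omega>)) \<omega>"

text \<open>The grid time takes countably many values, so evaluating \<open>W\<close> there needs
  only the measurability of each \<open>W t\<close>, not joint measurability in time.\<close>

lemma measurable_restart [measurable]: "restart \<delta> K e m d \<in> borel_measurable M"
proof -
  have "(\<lambda>\<omega>. W (real (LEAST k. hits \<delta> K e m (path \<omega>) k) / 2 ^ m + c) \<omega>) \<in> borel_measurable M"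
    if "0 \<le> c" for c
  proof (rule measurable_compose_countable[where f = "\<lambda>k. W (real k / 2 ^ m + c)"])
    show "W (real k / 2 ^ m + c) \<in> borel_measurable M" for k
      using that by (intro measurable_W) simp
  qed measurable
  from this[of "dyadic d"] this[of 0] show ?thesis
    unfolding restart_def grid_time_def by simp
qed

text \<open>The strong Markov property at the grid time, by splitting according to the first hit
  \<open>k\<close>: that event depends on the first \<open>k\<close> steps, the restarted values on
  the later ones.\<close>

lemma expectation_restart_grid:
  fixes \<phi> :: "nat \<times> nat \<Rightarrow> real \<Rightarrow> real"
  assumes "finite J" and m: "\<And>d. d \<in> J \<Longrightarrow> fst d \<le> m"
    and \<phi> [measurable]: "\<And>d. \<phi> d \<in> borel_measurable borel" and \<phi>01: "\<And>d u. \<phi> d u \<in> {0..1}"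
  shows "(\<integral>\<omega>. of_bool (visits \<delta> K e m \<omega>) * (\<Prod>d\<in>J. \<phi> d (restart \<delta> K e m d \<omega>)) \<partial>M) =
    (\<integral>\<omega>. of_bool (visits \<delta> K e m \<omega>) \<partial>M) * (\<integral>\<omega>. (\<Prod>d\<in>J. \<phi> d (W (dyadic d) \<omega>)) \<partial>M)"
proof -
  \<comment> \<open>\<open>c d\<close> counts the level-\<open>m\<close> steps up to
    \<open>dyadic d\<close>; the sum \<open>r\<close> serves as a crude common bound for these
    counts.\<close>
  define c where "c d = snd d * 2 ^ (m - fst d)" for d :: "nat \<times> nat"
  define r where "r = (\<Sum>d\<in>J. c d)"
  have cr: "c d \<le> r" if "d \<in> J" for d
    unfolding r_def by (rule member_le_sum) (use that \<open>finite J\<close> in auto)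
  define h where "h z = (\<Prod>d\<in>J. \<phi> d (\<Sum>i<c d. z i))" for z :: "nat \<Rightarrow> real"
  have h_meas: "h \<in> borel_measurable (PiM {..<r} (\<lambda>_. borel))"
    unfolding h_def
    by (intro borel_measurable_prod measurable_compose[OF _ \<phi>] borel_measurable_sum
        measurable_component_singleton) (use cr in force)
  have prod01: "0 \<le> (\<Prod>d\<in>J. \<phi> d (f d))" "(\<Prod>d\<in>J. \<phi> d (f d)) \<le> 1" for f
    using \<phi>01 by (auto intro!: prod_nonneg prod_le_1)
  have h_bdd: "\<bar>h z\<bar> \<le> 1" for z
    unfolding h_def using prod01[of "\<lambda>d. \<Sum>i<c d. z i"] by simp
  have h_eq: "h (\<lambda>i\<in>{..<r}. step m (k + i) \<omega>) =
      (\<Prod>d\<in>J. \<phi> d (W (real k / 2 ^ m + dyadic d) \<omega> - W (real k / 2 ^ m) \<omega>))" for k \<omega>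
    unfolding h_def
  proof (rule prod.cong[OF refl])
    fix d assume d: "d \<in> J"
    have "(\<Sum>i<c d. (\<lambda>i\<in>{..<r}. step m (k + i) \<omega>) i) = (\<Sum>i<c d. step m (k + i) \<omega>)"
      using cr[OF d] by (intro sum.cong) auto
    also have "\<dots> = W (real k / 2 ^ m + dyadic d) \<omega> - W (real k / 2 ^ m) \<omega>"
      using dyadic_eq_grid[OF m[OF d]] by (simp add: sum_step c_def add_divide_distrib)
    finally show "\<phi> d (\<Sum>i<c d. (\<lambda>i\<in>{..<r}. step m (k + i) \<omega>) i) =
        \<phi> d (W (real k / 2 ^ m + dyadic d) \<omega> - W (real k / 2 ^ m) \<omega>)" by simp
  qed
  \<comment> \<open>The sum of the first \<open>j\<close> steps stands for the path at grid point
    \<open>j\<close>. Thus \<open>A k\<close>, a first hit at \<open>k\<close>, is an event of the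
    first \<open>k\<close> steps alone.\<close>
  define hit where "hit z j \<longleftrightarrow> \<delta> \<le> real j / 2 ^ m \<and> real j / 2 ^ m < K \<and> \<bar>\<Sum>i<j. z i\<bar> < e"
    for z :: "nat \<Rightarrow> real" and j
  define A where "A k = {z \<in> space (PiM {..<k} (\<lambda>_. borel)). hit z k \<and> (\<forall>j<k. \<not> hit z j)}" for k
  have [measurable]: "Measurable.pred (PiM {..<k} (\<lambda>_. borel)) (\<lambda>z. hit z j)" if "j \<le> k" for j k
  proof -
    have [measurable]: "(\<lambda>z. \<Sum>i<j. z i) \<in> borel_measurable (PiM {..<k} (\<lambda>_. borel :: real measure))"
      by (intro borel_measurable_sum measurable_component_singleton) (use that in auto)
    show ?thesis unfolding hit_def by measurable
  qed
  have A_meas: "A k \<in> sets (PiM {..<k} (\<lambda>_. borel))" for k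
  proof -
    have "A k = {z \<in> space (PiM {..<k} (\<lambda>_. borel)). hit z k} \<inter>
        (\<Inter>j\<in>{..k}. {z \<in> space (PiM {..<k} (\<lambda>_. borel)). j < k \<longrightarrow> \<not> hit z j})"
      by (auto simp: A_def)
    also have "\<dots> \<in> sets (PiM {..<k} (\<lambda>_. borel))"
      by (intro sets.Int sets.finite_INT) (auto intro!: predE)
    finally show ?thesis .
  qed
  have hit_eq: "hit (\<lambda>i\<in>{..<k}. step m i \<omega>) j \<longleftrightarrow> hits \<delta> K e m (path \<omega>) j" if "j \<le> k" for j k \<omega>
  proof -
    have "(\<Sum>i<j. (\<lambda>i\<in>{..<k}. step m i \<omega>) i) = (\<Sum>i<j. step m (0 + i) \<omega>)"
      using that by (intro sum.cong) auto
    then show ?thesis unfolding sum_step by (simp add: hit_def hits_def)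
  qed
  \<comment> \<open>Grid points before the horizon \<open>K\<close> have index below
    \<open>N\<close>, which makes the splitting by first hit a finite sum.\<close>
  define N where "N = nat \<lceil>K * 2 ^ m\<rceil>"
  have N: "k < N" if "hits \<delta> K e m (path \<omega>) k" for k \<omega>
    using that unfolding N_def hits_def by (simp add: field_simps) linarith
  have first: "indicator (A k) (\<lambda>i\<in>{..<k}. step m i \<omega>) =
      (of_bool (visits \<delta> K e m \<omega> \<and> k = (LEAST k. hits \<delta> K e m (path \<omega>) k)) :: real)" for k \<omega>
  proof -
    have "(\<lambda>i\<in>{..<k}. step m i \<omega>) \<in> A k \<longleftrightarrow>
        hits \<delta> K e m (path \<omega>) k \<and> (\<forall>j<k. \<not> hits \<delta> K e m (path \<omega>) j)"
      by (auto simp: A_def hit_eq space_PiM)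
    also have "\<dots> \<longleftrightarrow> visits \<delta> K e m \<omega> \<and> k = (LEAST k. hits \<delta> K e m (path \<omega>) k)"
      unfolding visits_def
      by (metis (mono_tags, lifting) LeastI Least_le le_neq_implies_less linorder_not_less not_less_Least)
    finally show ?thesis by (simp add: indicator_def)
  qed
  \<comment> \<open>If the grid is visited, exactly one summand survives, the one of the first hit;
    otherwise all of them vanish.\<close>
  have decomp: "of_bool (visits \<delta> K e m \<omega>) * G (LEAST k. hits \<delta> K e m (path \<omega>) k) =
      (\<Sum>k<N. indicator (A k) (\<lambda>i\<in>{..<k}. step m i \<omega>) * G k)" for \<omega> and G :: "nat \<Rightarrow> real"
  proof (cases "visits \<delta> K e m \<omega>")
    case True
    then have "hits \<delta> K e m (path \<omega>) (LEAST k. hits \<delta> K e m (path \<omega>) k)"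
      unfolding visits_def by (auto intro: LeastI)
    from N[OF this] show ?thesis using True
      by (simp add: first of_bool_def if_distrib[of "\<lambda>x. x * _"] sum.delta' cong: if_cong)
  qed (simp add: first)
  have int: "integrable M (\<lambda>\<omega>. indicator (A k) (\<lambda>i\<in>{..<k}. step m i \<omega>) * h (\<lambda>i\<in>{..<r}. step m (k + i) \<omega>))" 
    "integrable M (\<lambda>\<omega>. indicator (A k) (\<lambda>i\<in>{..<k}. step m i \<omega>) :: real)" for k
    using h_bdd A_meas[measurable] h_meas[measurable]
    by (auto intro!: integrable_const_bound[where B = 1] simp: indicator_def abs_mult)
  have "of_bool (visits \<delta> K e m \<omega>) * (\<Prod>d\<in>J. \<phi> d (restart \<delta> K e m d \<omega>)) =
      (\<Sum>k<N. indicator (A k) (\<lambda>i\<in>{..<k}. step m i \<omega>) * h (\<lambda>i\<in>{..<r}. step m (k + i) \<omega>))" for \<omega>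
    using decomp[of \<omega> "\<lambda>k. h (\<lambda>i\<in>{..<r}. step m (k + i) \<omega>)"]
    by (simp add: h_eq restart_def grid_time_def)
  then have "(\<integral>\<omega>. of_bool (visits \<delta> K e m \<omega>) * (\<Prod>d\<in>J. \<phi> d (restart \<delta> K e m d \<omega>)) \<partial>M) =
    (\<integral>\<omega>. (\<Sum>k<N. indicator (A k) (\<lambda>i\<in>{..<k}. step m i \<omega>) * h (\<lambda>i\<in>{..<r}. step m (k + i) \<omega>)) \<partial>M)"
    by simp
  also have "\<dots> = (\<Sum>k<N. (\<integral>\<omega>. indicator (A k) (\<lambda>i\<in>{..<k}. step m i \<omega>) \<partial>M) *
      (\<integral>\<omega>. h (\<lambda>i\<in>{..<r}. step m i \<omega>) \<partial>M))"
    by (simp only: Bochner_Integration.integral_sum[OF int(1)]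
        expectation_past_times_future[OF A_meas h_meas h_bdd])
  also have "\<dots> = (\<integral>\<omega>. (\<Sum>k<N. indicator (A k) (\<lambda>i\<in>{..<k}. step m i \<omega>)) \<partial>M) *
      (\<integral>\<omega>. h (\<lambda>i\<in>{..<r}. step m i \<omega>) \<partial>M)"
    by (simp only: Bochner_Integration.integral_sum[OF int(2)] sum_distrib_right)
  also have "(\<lambda>\<omega>. (\<Sum>k<N. indicator (A k) (\<lambda>i\<in>{..<k}. step m i \<omega>))) = (\<lambda>\<omega>. of_bool (visits \<delta> K e m \<omega>) :: real)"
    using decomp[of _ "\<lambda>_. 1"] by simp
  also have "(\<lambda>\<omega>. h (\<lambda>i\<in>{..<r}. step m i \<omega>)) = (\<lambda>\<omega>. \<Prod>d\<in>J. \<phi> d (W (dyadic d) \<omega>))"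
    using h_eq[of 0] by simp
  finally show ?thesis .
qed

end

section \<open>Restarting at a zero\<close>

lemma (in prob_space) expectation_tendsto:
  fixes f :: "nat \<Rightarrow> 'a \<Rightarrow> real"
  assumes [measurable]: "\<And>n. f n \<in> borel_measurable M" "g \<in> borel_measurable M"
    and "AE \<omega> in M. (\<lambda>n. f n \<omega>) \<longlonglongrightarrow> g \<omega>" and "\<And>n \<omega>. \<bar>f n \<omega>\<bar> \<le> 1"
  shows "(\<lambda>n. \<integral>\<omega>. f n \<omega> \<partial>M) \<longlonglongrightarrow> (\<integral>\<omega>. g \<omega> \<partial>M)"
  by (rule integral_dominated_convergence[where w = "\<lambda>_. 1"]) (use assms in auto)

lemma of_bool_prod_le_one:
  fixes f :: "'i \<Rightarrow> real"
  assumes "\<And>d. d \<in> J \<Longrightarrow> f d \<in> {0..1}"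
  shows "\<bar>of_bool b * (\<Prod>d\<in>J. f d)\<bar> \<le> 1"
  using assms prod_nonneg[of J f] prod_le_1[of J f] by (auto simp: of_bool_def)

text \<open>Bounded convergence carries a factorisation from \<open>P m\<close>, \<open>V m\<close>
  to \<open>Q\<close>, \<open>R\<close>. Convergence of \<open>V\<close> is needed on
  \<open>Q\<close> only, since off \<open>Q\<close> the indicators eventually vanish. It serves
  twice: for the grid level going to infinity and for the neighbourhood shrinking to 0.\<close>

lemma (in prob_space) expectation_prod_limit:
  fixes \<phi> :: "'i \<Rightarrow> real \<Rightarrow> real"
  assumes \<phi>: "\<And>d. continuous_on UNIV (\<phi> d)" and \<phi>01: "\<And>d u. \<phi> d u \<in> {0..1}"
    and [measurable]: "\<And>m. Measurable.pred M (P m)" "Measurable.pred M Q"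
      "\<And>m d. V m d \<in> borel_measurable M" "\<And>d. R d \<in> borel_measurable M"
    and lim: "AE \<omega> in M. Q \<omega> \<longrightarrow> (\<forall>\<^sub>F m in sequentially. P m \<omega>) \<and> (\<forall>d. (\<lambda>m. V m d \<omega>) \<longlonglongrightarrow> R d \<omega>)"
    and lim': "AE \<omega> in M. \<not> Q \<omega> \<longrightarrow> (\<forall>\<^sub>F m in sequentially. \<not> P m \<omega>)"
    and eq: "\<forall>\<^sub>F m in sequentially. (\<integral>\<omega>. of_bool (P m \<omega>) * (\<Prod>d\<in>J. \<phi> d (V m d \<omega>)) \<partial>M) =
      (\<integral>\<omega>. of_bool (P m \<omega>) \<partial>M) * c"
  shows "(\<integral>\<omega>. of_bool (Q \<omega>) * (\<Prod>d\<in>J. \<phi> d (R d \<omega>)) \<partial>M) = (\<integral>\<omega>. of_bool (Q \<omega>) \<partial>M) * c"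
proof -
  have [measurable]: "\<phi> d \<in> borel_measurable borel" for d
    by (rule borel_measurable_continuous_onI[OF \<phi>])
  have P: "AE \<omega> in M. (\<lambda>m. of_bool (P m \<omega>) :: real) \<longlonglongrightarrow> of_bool (Q \<omega>)"
    using lim lim'
  proof eventually_elim
    case (elim \<omega>)
    then have "\<forall>\<^sub>F m in sequentially. P m \<omega> = Q \<omega>" by (cases "Q \<omega>") auto
    then show ?case by (intro tendsto_eventually, elim eventually_mono) simp
  qed
  have PV: "AE \<omega> in M. (\<lambda>m. of_bool (P m \<omega>) * (\<Prod>d\<in>J. \<phi> d (V m d \<omega>))) \<longlonglongrightarrow>
      of_bool (Q \<omega>) * (\<Prod>d\<in>J. \<phi> d (R d \<omega>))"
    using P lim lim'
  proof eventually_elim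
    case (elim \<omega>)
    show ?case
    proof (cases "Q \<omega>")
      case True
      then have "(\<lambda>m. \<phi> d (V m d \<omega>)) \<longlonglongrightarrow> \<phi> d (R d \<omega>)" for d
        using elim \<phi>[of d] by (intro continuous_on_tendsto_compose[of UNIV "\<phi> d"]) auto
      then show ?thesis using elim(1) by (intro tendsto_mult tendsto_prod)
    next
      case False
      then have "\<forall>\<^sub>F m in sequentially. \<not> P m \<omega>" using elim by simp
      then show ?thesis using False by (intro tendsto_eventually, elim eventually_mono) simp
    qed
  qed
  have "(\<lambda>m. \<integral>\<omega>. of_bool (P m \<omega>) * (\<Prod>d\<in>J. \<phi> d (V m d \<omega>)) \<partial>M) \<longlonglongrightarrow>
      (\<integral>\<omega>. of_bool (Q \<omega>) * (\<Prod>d\<in>J. \<phi> d (R d \<omega>)) \<partial>M)"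
    by (rule expectation_tendsto[OF _ _ PV]) (measurable, intro of_bool_prod_le_one \<phi>01)
  moreover have "(\<lambda>m. (\<integral>\<omega>. of_bool (P m \<omega>) \<partial>M) * c) \<longlonglongrightarrow> (\<integral>\<omega>. of_bool (Q \<omega>) \<partial>M) * c"
    by (rule tendsto_mult[OF expectation_tendsto[OF _ _ P] tendsto_const]) auto
  ultimately show ?thesis
    using LIMSEQ_unique tendsto_cong[OF eq] by blast
qed

context based_levy_process
begin

section \<open>Restarting at the entry into a fixed neighbourhood of 0\<close>

lemma AE_cadlag: "AE \<omega> in M. cadlag_path (path \<omega>)"
  using levy by (simp add: levy_process_def)

text \<open>Expressed through countably many grid points to be measurable; on cadlag paths with
  \<open>\<delta> \<ge> 0\<close> it means that some real time in the window has
  \<open>\<bar>W t \<omega>\<bar> < e\<close>.\<close>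

definition enters :: "real \<Rightarrow> real \<Rightarrow> real \<Rightarrow> 'a \<Rightarrow> bool" where
  "enters \<delta> K e \<omega> \<longleftrightarrow> (\<exists>m. visits \<delta> K e m \<omega>)"

text \<open>As a \<open>lim\<close> of measurable functions this is measurable even where the limit
  fails to exist; \<open>restart_nbhd_eq\<close> identifies it with the increments after the entry
  time.\<close>

definition restart_nbhd :: "real \<Rightarrow> real \<Rightarrow> real \<Rightarrow> nat \<times> nat \<Rightarrow> 'a \<Rightarrow> real" where
  "restart_nbhd \<delta> K e d \<omega> = lim (\<lambda>m. restart \<delta> K e m d \<omega>)"

lemma measurable_enters [measurable]: "Measurable.pred M (enters \<delta> K e)"
  unfolding enters_def by measurable

lemma measurable_restart_nbhd [measurable]: "restart_nbhd \<delta> K e d \<in> borel_measurable M"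
  unfolding restart_nbhd_def by measurable

lemma entersD: "enters \<delta> K e \<omega> \<Longrightarrow> \<exists>t. \<delta> \<le> t \<and> t < K \<and> \<bar>W t \<omega>\<bar> < e"
  by (auto simp: enters_def visits_def hits_def)

text \<open>The grid times approach the entry time from the right, so right continuity alone gives
  convergence of the restarted values.\<close>

lemma
  assumes "cadlag_path (path \<omega>)" "0 \<le> \<delta>" and t: "\<delta> \<le> t" "t < K" "\<bar>W t \<omega>\<bar> < e"
  shows eventually_visits: "\<forall>\<^sub>F m in sequentially. visits \<delta> K e m \<omega>"
    and entersI: "enters \<delta> K e \<omega>"
    and restart_tendsto: "(\<lambda>m. restart \<delta> K e m d \<omega>) \<longlonglongrightarrow>
      W (entry_time \<delta> e (path \<omega>) + dyadic d) \<omega> - W (entry_time \<delta> e (path \<omega>)) \<omega>"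
proof -
  have rc: "\<forall>t\<ge>0. continuous (at_right t) (path \<omega>)"
    using assms(1) by (auto simp: cadlag_path_def)
  note * = rc \<open>0 \<le> \<delta>\<close> t
  have "entry_time \<delta> e (path \<omega>) < K" using entry_time_le[of \<delta> t "path \<omega>" e] t by simp
  from eventually_hits[OF * this]
  show ev: "\<forall>\<^sub>F m in sequentially. visits \<delta> K e m \<omega>"
    by (rule eventually_mono) (auto simp: visits_def)
  show "enters \<delta> K e \<omega>"
    using eventually_happens[OF ev] by (auto simp: enters_def)
  have T0: "0 \<le> entry_time \<delta> e (path \<omega>)"
    using entry_time_ge[of \<delta> t "path \<omega>" e] t \<open>0 \<le> \<delta>\<close> by simp
  have "(\<lambda>m. W (grid_time \<delta> K e m (path \<omega>) + c) \<omega>) \<longlonglongrightarrow> W (entry_time \<delta> e (path \<omega>) + c) \<omega>"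
    if "0 \<le> c" for c
  proof (rule right_continuous_tendsto[where x = "path \<omega>"])
    show "continuous (at_right (entry_time \<delta> e (path \<omega>) + c)) (path \<omega>)"
      using rc T0 that by simp
    show "(\<lambda>m. grid_time \<delta> K e m (path \<omega>) + c) \<longlonglongrightarrow> entry_time \<delta> e (path \<omega>) + c"
      by (intro tendsto_intros grid_time_tendsto[OF *])
  qed (use entry_time_le_grid_time[OF *] in simp)
  from tendsto_diff[OF this[of "dyadic d"] this[of 0]]
  show "(\<lambda>m. restart \<delta> K e m d \<omega>) \<longlonglongrightarrow>
      W (entry_time \<delta> e (path \<omega>) + dyadic d) \<omega> - W (entry_time \<delta> e (path \<omega>)) \<omega>"
    by (simp add: restart_def)
qed

lemma restart_nbhd_eq:
  assumes "cadlag_path (path \<omega>)" "0 \<le> \<delta>" "enters \<delta> K e \<omega>"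
  shows "restart_nbhd \<delta> K e d \<omega> =
    W (entry_time \<delta> e (path \<omega>) + dyadic d) \<omega> - W (entry_time \<delta> e (path \<omega>)) \<omega>"
proof -
  from entersD[OF assms(3)] obtain t where "\<delta> \<le> t" "t < K" "\<bar>W t \<omega>\<bar> < e" by auto
  from restart_tendsto[OF assms(1,2) this, of d] show ?thesis
    unfolding restart_nbhd_def by (rule limI)
qed

text \<open>The limit \<open>m \<rightarrow> \<infinity>\<close> of
  \<open>expectation_restart_grid\<close>, which is available as soon as \<open>m\<close> exceeds
  the levels of the finitely many indices in \<open>J\<close>.\<close>

lemma expectation_restart_nbhd:
  fixes \<phi> :: "nat \<times> nat \<Rightarrow> real \<Rightarrow> real"
  assumes "0 \<le> \<delta>" "finite J" and \<phi>: "\<And>d. continuous_on UNIV (\<phi> d)" and \<phi>01: "\<And>d u. \<phi> d u \<in> {0..1}"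
  shows "(\<integral>\<omega>. of_bool (enters \<delta> K e \<omega>) * (\<Prod>d\<in>J. \<phi> d (restart_nbhd \<delta> K e d \<omega>)) \<partial>M) =
    (\<integral>\<omega>. of_bool (enters \<delta> K e \<omega>) \<partial>M) * (\<integral>\<omega>. (\<Prod>d\<in>J. \<phi> d (W (dyadic d) \<omega>)) \<partial>M)"
proof (rule expectation_prod_limit[OF \<phi> \<phi>01, where P = "visits \<delta> K e" and V = "restart \<delta> K e"])
  show "AE \<omega> in M. enters \<delta> K e \<omega> \<longrightarrow> (\<forall>\<^sub>F m in sequentially. visits \<delta> K e m \<omega>) \<and>
      (\<forall>d. (\<lambda>m. restart \<delta> K e m d \<omega>) \<longlonglongrightarrow> restart_nbhd \<delta> K e d \<omega>)"
    using AE_cadlag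
  proof eventually_elim
    case (elim \<omega>)
    then show ?case
      using entersD[of \<delta> K e \<omega>] \<open>0 \<le> \<delta>\<close> eventually_visits[of \<omega> \<delta>] restart_tendsto[of \<omega> \<delta>]
      by (auto simp: restart_nbhd_eq)
  qed
  show "AE \<omega> in M. \<not> enters \<delta> K e \<omega> \<longrightarrow> (\<forall>\<^sub>F m in sequentially. \<not> visits \<delta> K e m \<omega>)"
    by (auto simp: enters_def)
  have [measurable]: "\<phi> d \<in> borel_measurable borel" for d
    by (rule borel_measurable_continuous_onI[OF \<phi>])
  have "\<forall>\<^sub>F m in sequentially. \<forall>d\<in>J. fst d \<le> m"
    using \<open>finite J\<close> by (intro eventually_ball_finite) (auto simp: eventually_ge_at_top)
  then show "\<forall>\<^sub>F m in sequentially.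
      (\<integral>\<omega>. of_bool (visits \<delta> K e m \<omega>) * (\<Prod>d\<in>J. \<phi> d (restart \<delta> K e m d \<omega>)) \<partial>M) =
      (\<integral>\<omega>. of_bool (visits \<delta> K e m \<omega>) \<partial>M) * (\<integral>\<omega>. (\<Prod>d\<in>J. \<phi> d (W (dyadic d) \<omega>)) \<partial>M)"
    by eventually_elim (use \<open>finite J\<close> \<phi>01 in \<open>auto intro!: expectation_restart_grid\<close>)
qed measurable

section \<open>Shrinking the neighbourhood to 0\<close>

definition returns :: "real \<Rightarrow> real \<Rightarrow> 'a \<Rightarrow> bool" where
  "returns \<delta> K \<omega> \<longleftrightarrow> (\<forall>n. enters \<delta> K (1 / real (Suc n)) \<omega>)"

definition restart_zero :: "real \<Rightarrow> real \<Rightarrow> nat \<times> nat \<Rightarrow> 'a \<Rightarrow> real" where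
  "restart_zero \<delta> K d \<omega> = lim (\<lambda>n. restart_nbhd \<delta> K (1 / real (Suc n)) d \<omega>)"

lemma measurable_returns [measurable]: "Measurable.pred M (returns \<delta> K)"
  unfolding returns_def by measurable

lemma measurable_restart_zero [measurable]: "restart_zero \<delta> K d \<in> borel_measurable M"
  unfolding restart_zero_def by measurable

text \<open>Transfers \<open>restart_limit\<close> to the measurable variables.
  \<open>returns\<close> asks only for entry into every neighbourhood, so 0 may be approached merely
  as a left limit at \<open>T\<close>. The time \<open>T\<close> is used path by path, so its
  measurability is never at stake.\<close>

lemma restart_zero_limit:
  assumes "cadlag_path (path \<omega>)" "0 \<le> \<delta>" "returns \<delta> K \<omega>"
  obtains T where "\<delta> \<le> T" "T \<le> K"
    "\<And>d. (\<lambda>n. restart_nbhd \<delta> K (1 / real (Suc n)) d \<omega>) \<longlonglongrightarrow> restart_zero \<delta> K d \<omega>"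
    "\<And>s a. 0 \<le> s \<Longrightarrow> (\<lambda>n. dyadic (a n)) \<longlonglongrightarrow> s \<Longrightarrow> (\<And>n. s < dyadic (a n)) \<Longrightarrow>
      (\<lambda>n. restart_zero \<delta> K (a n) \<omega>) \<longlonglongrightarrow> W (T + s) \<omega>"
proof -
  have ent: "enters \<delta> K (1 / real (Suc n)) \<omega>" for n
    using assms(3) by (simp add: returns_def)
  have dec: "decseq (\<lambda>n. 1 / real (Suc n))"
    by (intro decseq_SucI) (simp add: field_simps)
  have null: "(\<lambda>n. 1 / real (Suc n)) \<longlonglongrightarrow> 0"
    by (rule LIMSEQ_Suc[OF lim_1_over_n])
  show thesis
  proof (rule restart_limit[OF assms(1,2) dec null entersD[OF ent]])
    fix T y assume T: "\<delta> \<le> T" "T \<le> K" and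
      y: "\<And>d. 0 \<le> d \<Longrightarrow> (\<lambda>n. W (entry_time \<delta> (1 / real (Suc n)) (path \<omega>) + d) \<omega> -
        W (entry_time \<delta> (1 / real (Suc n)) (path \<omega>)) \<omega>) \<longlonglongrightarrow> y d" and
      y': "\<And>s a. 0 \<le> s \<Longrightarrow> a \<longlonglongrightarrow> s \<Longrightarrow> (\<And>n. s < a n) \<Longrightarrow> (\<lambda>n. y (a n)) \<longlonglongrightarrow> W (T + s) \<omega>"
    have *: "(\<lambda>n. restart_nbhd \<delta> K (1 / real (Suc n)) d \<omega>) \<longlonglongrightarrow> y (dyadic d)" for d
      using y[of "dyadic d"] by (simp only: restart_nbhd_eq[OF assms(1,2) ent] dyadic_nonneg)
    then have **: "restart_zero \<delta> K d \<omega> = y (dyadic d)" for d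
      unfolding restart_zero_def by (rule limI)
    show thesis
    proof (rule that[OF T])
      show "(\<lambda>n. restart_nbhd \<delta> K (1 / real (Suc n)) d \<omega>) \<longlonglongrightarrow> restart_zero \<delta> K d \<omega>" for d
        using *[of d] by (simp only: **)
      show "(\<lambda>n. restart_zero \<delta> K (a n) \<omega>) \<longlonglongrightarrow> W (T + s) \<omega>"
        if "0 \<le> s" "(\<lambda>n. dyadic (a n)) \<longlonglongrightarrow> s" "\<And>n. s < dyadic (a n)" for s a
        unfolding ** by (rule y'[OF that])
    qed
  qed
qed

text \<open>The second passage to the limit, now along the radii
  \<open>1 / real (Suc n)\<close>.\<close>

lemma expectation_restart_zero:
  fixes \<phi> :: "nat \<times> nat \<Rightarrow> real \<Rightarrow> real"
  assumes "0 \<le> \<delta>" "finite J" and \<phi>: "\<And>d. continuous_on UNIV (\<phi> d)" and \<phi>01: "\<And>d u. \<phi> d u \<in> {0..1}"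
  shows "(\<integral>\<omega>. of_bool (returns \<delta> K \<omega>) * (\<Prod>d\<in>J. \<phi> d (restart_zero \<delta> K d \<omega>)) \<partial>M) =
    (\<integral>\<omega>. of_bool (returns \<delta> K \<omega>) \<partial>M) * (\<integral>\<omega>. (\<Prod>d\<in>J. \<phi> d (W (dyadic d) \<omega>)) \<partial>M)"
proof (rule expectation_prod_limit[OF \<phi> \<phi>01, where P = "\<lambda>n. enters \<delta> K (1 / real (Suc n))"
      and V = "\<lambda>n. restart_nbhd \<delta> K (1 / real (Suc n))"])
  show "AE \<omega> in M. returns \<delta> K \<omega> \<longrightarrow> (\<forall>\<^sub>F n in sequentially. enters \<delta> K (1 / real (Suc n)) \<omega>) \<and>
      (\<forall>d. (\<lambda>n. restart_nbhd \<delta> K (1 / real (Suc n)) d \<omega>) \<longlonglongrightarrow> restart_zero \<delta> K d \<omega>)"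
    using AE_cadlag
  proof eventually_elim
    case (elim \<omega>)
    show ?case
    proof
      assume ret: "returns \<delta> K \<omega>"
      show "(\<forall>\<^sub>F n in sequentially. enters \<delta> K (1 / real (Suc n)) \<omega>) \<and>
          (\<forall>d. (\<lambda>n. restart_nbhd \<delta> K (1 / real (Suc n)) d \<omega>) \<longlonglongrightarrow> restart_zero \<delta> K d \<omega>)"
        by (rule restart_zero_limit[OF elim \<open>0 \<le> \<delta>\<close> ret]) (use ret in \<open>simp add: returns_def\<close>)
    qed
  qed
  show "AE \<omega> in M. \<not> returns \<delta> K \<omega> \<longrightarrow> (\<forall>\<^sub>F n in sequentially. \<not> enters \<delta> K (1 / real (Suc n)) \<omega>)"
  proof (intro AE_I2 impI)
    fix \<omega> assume "\<not> returns \<delta> K \<omega>"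
    then obtain n0 where n0: "\<not> enters \<delta> K (1 / real (Suc n0)) \<omega>" by (auto simp: returns_def)
    \<comment> \<open>Entry into a smaller neighbourhood implies entry into a larger one, so a
      failure at \<open>n0\<close> persists for all later \<open>n\<close>.\<close>
    have "\<not> enters \<delta> K (1 / real (Suc n)) \<omega>" if "n0 \<le> n" for n
    proof
      have "1 / real (Suc n) \<le> 1 / real (Suc n0)" using that by (intro divide_left_mono) auto
      moreover assume "enters \<delta> K (1 / real (Suc n)) \<omega>"
      ultimately have "enters \<delta> K (1 / real (Suc n0)) \<omega>"
        unfolding enters_def visits_def hits_def by (meson less_le_trans)
      with n0 show False by simp
    qed
    then show "\<forall>\<^sub>F n in sequentially. \<not> enters \<delta> K (1 / real (Suc n)) \<omega>"
      by (auto simp: eventually_sequentially)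
  qed
  show "\<forall>\<^sub>F n in sequentially. (\<integral>\<omega>. of_bool (enters \<delta> K (1 / real (Suc n)) \<omega>) *
      (\<Prod>d\<in>J. \<phi> d (restart_nbhd \<delta> K (1 / real (Suc n)) d \<omega>)) \<partial>M) =
      (\<integral>\<omega>. of_bool (enters \<delta> K (1 / real (Suc n)) \<omega>) \<partial>M) *
      (\<integral>\<omega>. (\<Prod>d\<in>J. \<phi> d (W (dyadic d) \<omega>)) \<partial>M)"
    by (intro always_eventually allI expectation_restart_nbhd assms)
qed measurable

section \<open>Joint laws of the dyadic values\<close>

definition sample :: "'a \<Rightarrow> nat \<times> nat \<Rightarrow> real" where
  "sample \<omega> d = W (dyadic d) \<omega>"

definition restart_sample :: "real \<Rightarrow> real \<Rightarrow> 'a \<Rightarrow> nat \<times> nat \<Rightarrow> real" where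
  "restart_sample \<delta> K \<omega> d = restart_zero \<delta> K d \<omega>"

lemma measurable_sample [measurable]: "sample \<in> measurable M (PiM UNIV (\<lambda>_. borel))"
proof -
  have "sample = (\<lambda>\<omega>. \<lambda>d\<in>UNIV. W (dyadic d) \<omega>)" by (simp add: sample_def fun_eq_iff)
  also have "\<dots> \<in> measurable M (PiM UNIV (\<lambda>_. borel))"
    by (intro measurable_restrict measurable_W) simp
  finally show ?thesis .
qed

lemma measurable_restart_sample [measurable]:
  "restart_sample \<delta> K \<in> measurable M (PiM UNIV (\<lambda>_. borel))"
proof -
  have "restart_sample \<delta> K = (\<lambda>\<omega>. \<lambda>d\<in>UNIV. restart_zero \<delta> K d \<omega>)"
    by (simp add: restart_sample_def fun_eq_iff)
  also have "\<dots> \<in> measurable M (PiM UNIV (\<lambda>_. borel))"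
    by (intro measurable_restrict measurable_restart_zero)
  finally show ?thesis .
qed

text \<open>Continuous test functions are replaced by indicators of lower rays, which generate the
  product sigma-algebra.\<close>

lemma prob_restart_zero_rays:
  assumes "0 \<le> \<delta>" "finite J"
  shows "prob {\<omega> \<in> space M. returns \<delta> K \<omega> \<and> (\<forall>d\<in>J. restart_sample \<delta> K \<omega> d < c d)} =
    prob {\<omega> \<in> space M. returns \<delta> K \<omega>} * prob {\<omega> \<in> space M. \<forall>d\<in>J. sample \<omega> d < c d}"
proof -
  \<comment> \<open>For \<open>n > 0\<close> this ramp is 1 up to \<open>c d - 1 / n\<close> and 0
    from \<open>c d\<close> on. It tends to the indicator of the open ray, matching the strict
    inequality.\<close>
  define \<phi> where "\<phi> n d u = min 1 (max 0 (real n * (c d - u)))" for n d u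
  have \<phi>_cont: "continuous_on UNIV (\<phi> n d)" for n d
    unfolding \<phi>_def by (intro continuous_intros)
  have [measurable]: "\<phi> n d \<in> borel_measurable borel" for n d
    by (rule borel_measurable_continuous_onI[OF \<phi>_cont])
  have \<phi>01: "\<phi> n d u \<in> {0..1}" for n d u by (auto simp: \<phi>_def)
  have \<phi>_lim: "(\<lambda>n. \<phi> n d u) \<longlonglongrightarrow> of_bool (u < c d)" for d u
  proof (cases "u < c d")
    case True
    have "filterlim (\<lambda>n. real n * (c d - u)) at_top sequentially"
      using True by (intro filterlim_at_top_mult_tendsto_pos[OF tendsto_const _ filterlim_real_sequentially]) auto
    then have "\<forall>\<^sub>F n in sequentially. 1 \<le> real n * (c d - u)" by (simp add: filterlim_at_top)
    then show ?thesis using True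
      by (intro tendsto_eventually) (auto elim!: eventually_mono simp: \<phi>_def)
  next
    case False
    then have "real n * (c d - u) \<le> 0" for n by (intro mult_nonneg_nonpos) auto
    then have "\<phi> n d u = 0" for n by (simp add: \<phi>_def max_absorb1)
    then show ?thesis using False by simp
  qed
  have lim: "(\<lambda>n. of_bool b * (\<Prod>d\<in>J. \<phi> n d (f d))) \<longlonglongrightarrow> of_bool (b \<and> (\<forall>d\<in>J. f d < c d))" for f b
  proof -
    have "(\<lambda>n. of_bool b * (\<Prod>d\<in>J. \<phi> n d (f d))) \<longlonglongrightarrow> of_bool b * (\<Prod>d\<in>J. of_bool (f d < c d))"
      by (intro tendsto_mult tendsto_prod tendsto_const \<phi>_lim)
    also have "of_bool b * (\<Prod>d\<in>J. of_bool (f d < c d)) = (of_bool (b \<and> (\<forall>d\<in>J. f d < c d)) :: real)"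
      using \<open>finite J\<close> by (cases "\<forall>d\<in>J. f d < c d") (auto intro!: prod_zero)
    finally show ?thesis .
  qed
  have [measurable]: "(\<lambda>\<omega>. W (dyadic d) \<omega>) \<in> borel_measurable M" for d by (intro measurable_W) simp
  have rays: "(\<lambda>n. \<integral>\<omega>. of_bool (P \<omega>) * (\<Prod>d\<in>J. \<phi> n d (V d \<omega>)) \<partial>M) \<longlonglongrightarrow>
      (\<integral>\<omega>. of_bool (P \<omega> \<and> (\<forall>d\<in>J. V d \<omega> < c d)) \<partial>M)"
    if [measurable]: "Measurable.pred M P" "\<And>d. V d \<in> borel_measurable M" for P V
  proof (rule expectation_tendsto)
    show "(\<lambda>\<omega>. of_bool (P \<omega> \<and> (\<forall>d\<in>J. V d \<omega> < c d)) :: real) \<in> borel_measurable M"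
      using \<open>finite J\<close> by measurable
    show "AE \<omega> in M. (\<lambda>n. of_bool (P \<omega>) * (\<Prod>d\<in>J. \<phi> n d (V d \<omega>))) \<longlonglongrightarrow>
        of_bool (P \<omega> \<and> (\<forall>d\<in>J. V d \<omega> < c d))"
      by (intro AE_I2 lim)
    show "\<bar>of_bool (P \<omega>) * (\<Prod>d\<in>J. \<phi> n d (V d \<omega>))\<bar> \<le> 1" for n \<omega>
      by (intro of_bool_prod_le_one \<phi>01)
  qed measurable
  have "(\<lambda>n. \<integral>\<omega>. of_bool (returns \<delta> K \<omega>) * (\<Prod>d\<in>J. \<phi> n d (restart_zero \<delta> K d \<omega>)) \<partial>M) \<longlonglongrightarrow>
      (\<integral>\<omega>. of_bool (returns \<delta> K \<omega> \<and> (\<forall>d\<in>J. restart_zero \<delta> K d \<omega> < c d)) \<partial>M)"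
    by (rule rays) measurable
  moreover have "(\<lambda>n. \<integral>\<omega>. of_bool True * (\<Prod>d\<in>J. \<phi> n d (W (dyadic d) \<omega>)) \<partial>M) \<longlonglongrightarrow>
      (\<integral>\<omega>. of_bool (True \<and> (\<forall>d\<in>J. W (dyadic d) \<omega> < c d)) \<partial>M)"
    by (rule rays) measurable
  then have "(\<lambda>n. (\<integral>\<omega>. of_bool (returns \<delta> K \<omega>) \<partial>M) * (\<integral>\<omega>. (\<Prod>d\<in>J. \<phi> n d (W (dyadic d) \<omega>)) \<partial>M)) \<longlonglongrightarrow>
      (\<integral>\<omega>. of_bool (returns \<delta> K \<omega>) \<partial>M) * (\<integral>\<omega>. of_bool (\<forall>d\<in>J. W (dyadic d) \<omega> < c d) \<partial>M)"
    using tendsto_mult[OF tendsto_const] by (simp only: of_bool_eq mult_1 simp_thms)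
  ultimately have eq: "(\<integral>\<omega>. of_bool (returns \<delta> K \<omega> \<and> (\<forall>d\<in>J. restart_zero \<delta> K d \<omega> < c d)) \<partial>M) =
      (\<integral>\<omega>. of_bool (returns \<delta> K \<omega>) \<partial>M) * (\<integral>\<omega>. of_bool (\<forall>d\<in>J. W (dyadic d) \<omega> < c d) \<partial>M :: real)"
    unfolding expectation_restart_zero[OF assms \<phi>_cont \<phi>01] by (rule LIMSEQ_unique)
  have prob_eq: "(\<integral>\<omega>. of_bool (P \<omega>) \<partial>M :: real) = prob {\<omega> \<in> space M. P \<omega>}"
    if P: "Measurable.pred M P" for P
  proof -
    have "(\<integral>\<omega>. of_bool (P \<omega>) \<partial>M :: real) = (\<integral>\<omega>. indicator {\<omega> \<in> space M. P \<omega>} \<omega> \<partial>M)"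
      by (intro Bochner_Integration.integral_cong) (auto simp: indicator_def)
    then show ?thesis using predE[OF P] by simp
  qed
  have "Measurable.pred M (\<lambda>\<omega>. returns \<delta> K \<omega> \<and> (\<forall>d\<in>J. restart_zero \<delta> K d \<omega> < c d))"
    "Measurable.pred M (\<lambda>\<omega>. \<forall>d\<in>J. W (dyadic d) \<omega> < c d)"
    using \<open>finite J\<close> by measurable
  note this[THEN prob_eq] measurable_returns[THEN prob_eq]
  with eq show ?thesis unfolding restart_sample_def sample_def by simp
qed

end

section \<open>The perpetual integral as a functional of the dyadic samples\<close>

text \<open>Recovers a right-continuous path from its dyadic values. The approximants lie strictly
  to the right of \<open>t\<close>, so values at \<open>t\<close> itself do not enter.\<close>

definition right_value :: "(nat \<times> nat \<Rightarrow> real) \<Rightarrow> real \<Rightarrow> real" where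
  "right_value w t = lim (\<lambda>p. w (p, dyadic_above p t))"

text \<open>Joint measurability makes the time integral a measurable functional of the samples. It
  holds because \<open>dyadic_above p\<close> selects among countably many coordinates.\<close>

lemma measurable_right_value [measurable]:
  "(\<lambda>(w, t). right_value w t) \<in> borel_measurable (PiM UNIV (\<lambda>_. borel) \<Otimes>\<^sub>M lborel)"
proof -
  have [measurable]: "dyadic_above p \<in> borel \<rightarrow>\<^sub>M count_space UNIV" for p
    unfolding dyadic_above_def by measurable
  have [measurable]: "(\<lambda>x. fst x (p, dyadic_above p (snd x))) \<in>
      borel_measurable (PiM UNIV (\<lambda>_. borel :: real measure) \<Otimes>\<^sub>M (lborel :: real measure))" for p
    by (rule measurable_compose_countable[where f = "\<lambda>k x. fst x (p, k)"]) measurable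
  show ?thesis unfolding right_value_def case_prod_beta by measurable
qed

lemma measurable_right_value_section [measurable]:
  "right_value w \<in> borel_measurable borel"
  using measurable_compose[OF measurable_Pair1'[of w "PiM UNIV (\<lambda>_. borel)" lborel] measurable_right_value]
  by (simp add: space_PiM)

definition sample_integral :: "(real \<Rightarrow> real) \<Rightarrow> real set \<Rightarrow> (nat \<times> nat \<Rightarrow> real) \<Rightarrow> ennreal" where
  "sample_integral g S w = (\<integral>\<^sup>+ t \<in> S. ennreal (g (right_value w t)) \<partial>lborel)"

lemma measurable_sample_integral [measurable]:
  assumes [measurable]: "g \<in> borel_measurable borel" "S \<in> sets borel"
  shows "sample_integral g S \<in> borel_measurable (PiM UNIV (\<lambda>_. borel))"
  unfolding sample_integral_def
  by (rule lborel.borel_measurable_nn_integral)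
    (use measurable_right_value in \<open>simp add: case_prod_beta\<close>, measurable)

text \<open>Bounded convergence for indicators; all three final limits, in \<open>\<delta>\<close>,
  \<open>K\<close> and \<open>\<eta>\<close>, rest on it.\<close>

lemma (in prob_space) prob_tendsto_zero:
  assumes [measurable]: "\<And>n. Measurable.pred M (P n)"
    and "AE \<omega> in M. \<forall>\<^sub>F n in sequentially. \<not> P n \<omega>"
  shows "(\<lambda>n. prob {\<omega> \<in> space M. P n \<omega>}) \<longlonglongrightarrow> 0"
proof -
  have "(\<lambda>n. \<integral>\<omega>. indicator {\<omega> \<in> space M. P n \<omega>} \<omega> \<partial>M) \<longlonglongrightarrow> (\<integral>\<omega>. 0 \<partial>M :: real)"
  proof (rule expectation_tendsto)
    show "AE \<omega> in M. (\<lambda>n. indicator {\<omega> \<in> space M. P n \<omega>} \<omega> :: real) \<longlonglongrightarrow> 0"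
      using assms(2)
    proof eventually_elim
      case (elim \<omega>)
      then show ?case by (intro tendsto_eventually, elim eventually_mono) simp
    qed
  qed (auto simp: indicator_def)
  then show ?thesis by simp
qed

section \<open>The law of the restarted samples and the atom estimate\<close>

context based_levy_process
begin

text \<open>Both sides are finite measures in \<open>B\<close> that agree on finite intersections of
  lower rays, hence everywhere. It says that, given \<open>returns\<close>, the restarted samples
  have the law of the original ones.\<close>

lemma prob_restart_sample:
  assumes "0 \<le> \<delta>" and B: "B \<in> sets (PiM UNIV (\<lambda>_. borel))"
  shows "prob {\<omega> \<in> space M. returns \<delta> K \<omega> \<and> restart_sample \<delta> K \<omega> \<in> B} =
    prob {\<omega> \<in> space M. returns \<delta> K \<omega>} * prob {\<omega> \<in> space M. sample \<omega> \<in> B}"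
proof -
  let ?P = "PiM UNIV (\<lambda>_ :: nat \<times> nat. borel :: real measure)"
  let ?R = "{\<omega> \<in> space M. returns \<delta> K \<omega>}"
  \<comment> \<open>\<open>N1\<close> is the law of the restarted samples on the event
    \<open>returns\<close>; \<open>N2\<close> is the law of the original samples scaled to the same
    mass.\<close>
  define N1 where "N1 = distr (density M (indicator ?R)) ?P (restart_sample \<delta> K)"
  define N2 where "N2 = scale_measure (ennreal (prob ?R)) (distr M ?P sample)"
  have N1: "emeasure N1 B = ennreal (prob {\<omega> \<in> space M. returns \<delta> K \<omega> \<and> restart_sample \<delta> K \<omega> \<in> B})"
    if [measurable]: "B \<in> sets ?P" for B
  proof -
    have "emeasure N1 B = emeasure M (?R \<inter> (restart_sample \<delta> K -` B \<inter> space M))"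
      unfolding N1_def by (simp add: emeasure_distr emeasure_restricted)
    also have "?R \<inter> (restart_sample \<delta> K -` B \<inter> space M) =
        {\<omega> \<in> space M. returns \<delta> K \<omega> \<and> restart_sample \<delta> K \<omega> \<in> B}" by auto
    finally show ?thesis by (simp add: emeasure_eq_measure)
  qed
  have N2: "emeasure N2 B = ennreal (prob ?R * prob {\<omega> \<in> space M. sample \<omega> \<in> B})"
    if [measurable]: "B \<in> sets ?P" for B
  proof -
    have "sample -` B \<inter> space M = {\<omega> \<in> space M. sample \<omega> \<in> B}" by auto
    then show ?thesis
      unfolding N2_def by (simp add: emeasure_distr emeasure_eq_measure ennreal_mult)
  qed
  \<comment> \<open>The cylinders with finitely many coordinates in lower rays, in the shape that
    the generator theorem for product sigma-algebras uses.\<close>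
  define E where "E = {{f \<in> (UNIV :: (nat \<times> nat) set) \<rightarrow>\<^sub>E (UNIV :: real set). \<forall>i\<in>j. f i \<in> A i} | A j.
      j \<in> Collect finite \<and> A \<in> (\<Pi> i\<in>j. range lessThan)}"
  have "sets (PiM UNIV (\<lambda>_ :: nat \<times> nat. sigma UNIV (range (lessThan :: real \<Rightarrow> _)))) = sets (sigma (UNIV \<rightarrow>\<^sub>E UNIV) E)"
    unfolding E_def
  proof (rule sets_PiM_sigma)
    have "(UNIV :: real set) = \<Union> (lessThan ` range real)"
      using reals_Archimedean2 by auto
    then show "\<exists>S\<subseteq>range lessThan. countable S \<and> (UNIV :: real set) = \<Union> S"
      by (intro exI[of _ "lessThan ` range real"] conjI image_mono) simp_all
    have "x \<in> \<Union> (Collect finite)" for x :: "nat \<times> nat"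
      by (rule UnionI[of "{x}"]) simp_all
    then show "\<Union> (Collect finite) = (UNIV :: (nat \<times> nat) set)"
      by (rule UNIV_eq_I[symmetric])
  qed auto
  then have sets_P: "sets ?P = sigma_sets UNIV E"
    by (simp add: borel_Iio[symmetric])
  have E_form: "\<exists>J c. finite J \<and> X = {f. \<forall>d\<in>J. f d < c d}" if "X \<in> E" for X
  proof -
    from that obtain A J where J: "finite J" and A: "A \<in> (\<Pi> i\<in>J. range lessThan)"
      and X: "X = {f. \<forall>i\<in>J. f i \<in> A i}" by (auto simp: E_def)
    from A have "\<forall>d\<in>J. \<exists>c. A d = {..<c}" by auto
    then obtain c where "\<forall>d\<in>J. A d = {..<c d}" by metis
    then have "X = {f. \<forall>d\<in>J. f d < c d}" unfolding X by auto
    with J show ?thesis by blast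
  qed
  have E_I: "{f. \<forall>d\<in>J. f d < c d} \<in> E" if "finite J" for J c
    unfolding E_def using that
    by (intro CollectI exI[of _ "\<lambda>d. {..<c d}"] exI[of _ J]) simp
  have "N1 = N2"
  proof (rule measure_eqI_generator_eq[where E = E and \<Omega> = UNIV and A = "\<lambda>_. UNIV"])
    show "Int_stable E"
    proof (rule Int_stableI)
      fix X Y assume "X \<in> E" "Y \<in> E"
      then obtain J c J' c' where *: "finite J" "X = {f. \<forall>d\<in>J. f d < c d}"
        "finite J'" "Y = {f. \<forall>d\<in>J'. f d < c' d}" by (blast dest!: E_form)
      \<comment> \<open>A coordinate bounded in both cylinders gets the smaller bound, any other its
        only bound.\<close>
      have "X \<inter> Y = {f. \<forall>d\<in>J \<union> J'. f d <
          (if d \<in> J \<and> d \<in> J' then min (c d) (c' d) else if d \<in> J then c d else c' d)}"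
        unfolding * by (auto split: if_splits)
      also have "\<dots> \<in> E" using * by (intro E_I) auto
      finally show "X \<inter> Y \<in> E" .
    qed
    show "emeasure N1 X = emeasure N2 X" if "X \<in> E" for X
    proof -
      have "X \<in> sets ?P" using that sets_P by auto
      moreover obtain J c where "finite J" "X = {f. \<forall>d\<in>J. f d < c d}"
        using E_form[OF \<open>X \<in> E\<close>] by auto
      ultimately show ?thesis
        using prob_restart_zero_rays[OF \<open>0 \<le> \<delta>\<close>, of J K c] by (simp add: N1 N2)
    qed
    \<comment> \<open>The empty index set yields the whole space, so a constant sequence exhausts it
      with finite mass.\<close>
    show "range (\<lambda>_. UNIV) \<subseteq> E" using E_I[of "{}"] by simp
    show "emeasure N1 UNIV \<noteq> \<infinity>" using N1[of UNIV] sets.top[of ?P] by (simp add: space_PiM)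
  qed (simp_all add: N1_def N2_def sets_P)
  then show ?thesis
    using N1[OF B] N2[OF B] by (simp add: ennreal_inj)
qed

section \<open>Pathwise splitting of the integral\<close>

lemma right_value_sample:
  assumes "cadlag_path (path \<omega>)" "0 \<le> t"
  shows "right_value (sample \<omega>) t = W t \<omega>"
proof -
  have "(\<lambda>p. path \<omega> (real (dyadic_above p t) / 2 ^ p)) \<longlonglongrightarrow> path \<omega> t"
    by (rule right_continuous_tendsto[OF _ _ dyadic_above_tendsto])
      (use assms dyadic_above_bounds(1) in \<open>auto simp: cadlag_path_def less_imp_le\<close>)
  then show ?thesis
    unfolding right_value_def sample_def dyadic_def by (intro limI) simp
qed

text \<open>The restarted samples may be left limits of the path, but reading them strictly to the
  right of \<open>s\<close> gives back the value \<open>W (T + s)\<close>.\<close>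

lemma right_value_restart_sample:
  assumes "cadlag_path (path \<omega>)" "0 \<le> \<delta>" "returns \<delta> K \<omega>"
  obtains T where "\<delta> \<le> T" "T \<le> K"
    "\<And>s. 0 \<le> s \<Longrightarrow> right_value (restart_sample \<delta> K \<omega>) s = W (T + s) \<omega>"
proof (rule restart_zero_limit[OF assms])
  fix T assume T: "\<delta> \<le> T" "T \<le> K" and
    lim: "\<And>s a. 0 \<le> s \<Longrightarrow> (\<lambda>n. dyadic (a n)) \<longlonglongrightarrow> s \<Longrightarrow> (\<And>n. s < dyadic (a n)) \<Longrightarrow>
      (\<lambda>n. restart_zero \<delta> K (a n) \<omega>) \<longlonglongrightarrow> W (T + s) \<omega>"
  show thesis
  proof (rule that[OF T])
    fix s :: real assume s: "0 \<le> s"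
    have "(\<lambda>p. restart_zero \<delta> K (p, dyadic_above p s) \<omega>) \<longlonglongrightarrow> W (T + s) \<omega>"
      by (rule lim[OF s])
        (use dyadic_above_tendsto[OF s] dyadic_above_bounds(1)[OF s] in \<open>simp_all add: dyadic_def\<close>)
    then show "right_value (restart_sample \<delta> K \<omega>) s = W (T + s) \<omega>"
      unfolding right_value_def restart_sample_def by (rule limI)
  qed
qed

text \<open>\<open>A\<close> is the integral over \<open>[0, T)\<close>. The bound
  \<open>T \<le> K\<close> gives the upper estimate, \<open>T \<ge> \<delta> > 0\<close> together
  with positivity of \<open>g\<close> near 0 gives \<open>A > 0\<close>, and translation by
  \<open>T\<close> turns the remainder into the restarted integral.\<close>

lemma sample_integral_restart:
  assumes [measurable]: "g \<in> borel_measurable borel"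
    and g_pos: "open U" "0 \<in> U" "\<And>x. x \<in> U \<Longrightarrow> 0 < g x"
    and \<omega>: "cadlag_path (path \<omega>)" and "0 < \<delta>" "returns \<delta> K \<omega>"
  obtains A where "0 < A" "A \<le> sample_integral g {0..K} (sample \<omega>)"
    "sample_integral g {0..} (sample \<omega>) = A + sample_integral g {0..} (restart_sample \<delta> K \<omega>)"
proof (rule right_value_restart_sample[OF \<omega> less_imp_le[OF \<open>0 < \<delta>\<close>] \<open>returns \<delta> K \<omega>\<close>])
  fix T assume T: "\<delta> \<le> T" "T \<le> K"
    and shift: "\<And>s. 0 \<le> s \<Longrightarrow> right_value (restart_sample \<delta> K \<omega>) s = W (T + s) \<omega>"
  define f where "f t = ennreal (g (right_value (sample \<omega>) t))" for t
  have [measurable]: "f \<in> borel_measurable borel" unfolding f_def by measurable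
  define A where "A = (\<integral>\<^sup>+ t \<in> {0..<T}. f t \<partial>lborel)"
  have "0 < T" using T \<open>0 < \<delta>\<close> by simp
  show thesis
  proof (rule that)
    show "A \<le> sample_integral g {0..K} (sample \<omega>)"
      unfolding A_def sample_integral_def f_def using T
      by (intro nn_integral_mono) (auto simp: indicator_def)
    have "continuous (at_right 0) (path \<omega>)"
      using \<omega> by (auto simp: cadlag_path_def)
    then have "(path \<omega> \<longlongrightarrow> 0) (at_right 0)"
      by (simp add: continuous_within)
    then have "\<forall>\<^sub>F t in at_right 0. path \<omega> t \<in> U"
      using g_pos by (intro topological_tendstoD) auto
    then obtain b where b: "0 < b" "\<And>t. 0 < t \<Longrightarrow> t < b \<Longrightarrow> path \<omega> t \<in> U"
      unfolding eventually_at_right_field by auto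
    \<comment> \<open>The path starts at 0 and is right continuous there, so it stays in
      \<open>U\<close> for a short positive time; before \<open>T\<close> this contributes an
      interval of positive length.\<close>
    have pos: "f t \<noteq> 0" if "t \<in> {0<..<min b T}" for t
      using that g_pos(3)[OF b(2)[of t]] by (simp add: f_def right_value_sample[OF \<omega>] ennreal_eq_0_iff)
    show "0 < A"
    proof (rule ccontr)
      assume "\<not> 0 < A"
      then have "AE t in lborel. f t * indicator {0..<T} t = 0"
        unfolding A_def by (subst nn_integral_0_iff_AE[symmetric]) auto
      then have "AE t in lborel. t \<notin> {0<..<min b T}"
        by eventually_elim (use pos in \<open>force simp: indicator_def split: if_splits\<close>)
      then have "emeasure lborel {0<..<min b T} = 0"
        using AE_iff_null_sets[of "{0<..<min b T}" lborel] by (simp add: null_sets_def)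
      then show False using b(1) \<open>0 < T\<close> by (simp add: ennreal_eq_0_iff split: if_splits)
    qed
    have "sample_integral g {0..} (sample \<omega>) =
        (\<integral>\<^sup>+ t. f t * indicator {0..<T} t + f t * indicator {T..} t \<partial>lborel)"
      unfolding sample_integral_def f_def using \<open>0 < T\<close>
      by (intro nn_integral_cong) (auto simp: indicator_def)
    also have "\<dots> = A + (\<integral>\<^sup>+ t. f t * indicator {T..} t \<partial>lborel)"
      unfolding A_def by (intro nn_integral_add) auto
    also have "(\<integral>\<^sup>+ t. f t * indicator {T..} t \<partial>lborel) =
        (\<integral>\<^sup>+ s. f (T + s) * indicator {T..} (T + s) \<partial>lborel)"
      by (subst nn_integral_real_affine[where c = 1 and t = T]) auto
    also have "\<dots> = sample_integral g {0..} (restart_sample \<delta> K \<omega>)"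
      unfolding sample_integral_def f_def using \<open>0 < T\<close>
      by (intro nn_integral_cong) (auto simp: indicator_def shift right_value_sample[OF \<omega>])
    finally show "sample_integral g {0..} (sample \<omega>) =
        A + sample_integral g {0..} (restart_sample \<delta> K \<omega>)" .
  qed
qed

section \<open>The probability of an atom\<close>

lemma prob_atom_le:
  assumes g [measurable]: "g \<in> borel_measurable borel"
    and g_pos: "open U" "0 \<in> U" "\<And>x. x \<in> U \<Longrightarrow> 0 < g x"
    and "0 < \<delta>" and c: "c < \<infinity>"
  shows "prob {\<omega> \<in> space M. sample_integral g {0..} (sample \<omega>) = c} \<le>
    prob {\<omega> \<in> space M. \<not> returns \<delta> K \<omega>} +
    (prob {\<omega> \<in> space M. \<eta> < sample_integral g {0..K} (sample \<omega>)} +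
     prob {\<omega> \<in> space M. sample_integral g {0..} (sample \<omega>) < c \<and>
       c \<le> \<eta> + sample_integral g {0..} (sample \<omega>)})"
proof -
  \<comment> \<open>\<open>B\<close> is a set of samples, so \<open>prob_restart_sample\<close>
    applies to it. The complement of \<open>returns\<close> plays the part of the event
    \<open>T \<ge> K\<close>.\<close>
  define B where "B = {w \<in> space (PiM UNIV (\<lambda>_. borel)). sample_integral g {0..} w < c \<and>
    c \<le> \<eta> + sample_integral g {0..} w}"
  have B [measurable]: "B \<in> sets (PiM UNIV (\<lambda>_. borel))" unfolding B_def by measurable
  let ?E1 = "{\<omega> \<in> space M. \<not> returns \<delta> K \<omega>}"
  let ?E2 = "{\<omega> \<in> space M. \<eta> < sample_integral g {0..K} (sample \<omega>)}"
  let ?E3 = "{\<omega> \<in> space M. returns \<delta> K \<omega> \<and> restart_sample \<delta> K \<omega> \<in> B}"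
  have "prob {\<omega> \<in> space M. sample_integral g {0..} (sample \<omega>) = c} \<le> prob (?E1 \<union> (?E2 \<union> ?E3))"
  proof (rule finite_measure_mono_AE)
    show "AE \<omega> in M. \<omega> \<in> {\<omega> \<in> space M. sample_integral g {0..} (sample \<omega>) = c} \<longrightarrow>
        \<omega> \<in> ?E1 \<union> (?E2 \<union> ?E3)"
      using AE_cadlag
    proof eventually_elim
      case (elim \<omega>)
      have "restart_sample \<delta> K \<omega> \<in> B"
        if c_eq: "sample_integral g {0..} (sample \<omega>) = c" and ret: "returns \<delta> K \<omega>"
          and small: "\<not> \<eta> < sample_integral g {0..K} (sample \<omega>)"
      proof (rule sample_integral_restart[OF g g_pos elim \<open>0 < \<delta>\<close> ret])
        fix A assume A: "0 < A" "A \<le> sample_integral g {0..K} (sample \<omega>)"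
          "sample_integral g {0..} (sample \<omega>) = A + sample_integral g {0..} (restart_sample \<delta> K \<omega>)"
        let ?I = "sample_integral g {0..} (restart_sample \<delta> K \<omega>)"
        \<comment> \<open>Finiteness of \<open>c\<close> permits cancellation, which turns
          \<open>A > 0\<close> into the strict inequality \<open>?I < c\<close>.\<close>
        have "A + ?I \<noteq> \<infinity>" using c c_eq unfolding A(3) by simp
        then have "?I + 0 < ?I + A"
          using A(1) by (subst ennreal_add_left_cancel_less) auto
        then have "?I < A + ?I" by (simp add: add.commute)
        moreover have "A + ?I \<le> \<eta> + ?I" using A(2) small by (intro add_right_mono) simp
        ultimately show ?thesis using A(3) c_eq by (simp add: B_def space_PiM)
      qed
      then show ?case by auto
    qed
  qed measurable
  also have "\<dots> \<le> prob ?E1 + (prob ?E2 + prob ?E3)"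
    by (intro order.trans[OF measure_Un_le] add_left_mono) measurable
  \<comment> \<open>The probability factorises, and the factor for \<open>returns\<close> is at most
    1.\<close>
  also have "prob ?E3 \<le> prob {\<omega> \<in> space M. sample \<omega> \<in> B}"
    using prob_restart_sample[OF less_imp_le[OF \<open>0 < \<delta>\<close>] B, of K]
    by (simp add: mult_left_le_one_le)
  also have "{\<omega> \<in> space M. sample \<omega> \<in> B} = {\<omega> \<in> space M. sample_integral g {0..} (sample \<omega>) < c \<and>
       c \<le> \<eta> + sample_integral g {0..} (sample \<omega>)}"
    by (simp add: B_def space_PiM)
  finally show ?thesis by simp
qed

text \<open>A zero in \<open>(0, K)\<close> lies in the window as soon as \<open>\<delta>\<close>
  drops below it, and a zero enters every neighbourhood.\<close>

lemma prob_no_return_tendsto: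
  assumes regular: "AE \<omega> in M. \<forall>K>0. \<exists>t>0. t < K \<and> W t \<omega> = 0" and "0 < K"
  shows "(\<lambda>j. prob {\<omega> \<in> space M. \<not> returns (1 / real (Suc j)) K \<omega>}) \<longlonglongrightarrow> 0"
proof (rule prob_tendsto_zero)
  show "AE \<omega> in M. \<forall>\<^sub>F j in sequentially. \<not> \<not> returns (1 / real (Suc j)) K \<omega>"
    using regular AE_cadlag
  proof eventually_elim
    case (elim \<omega>)
    then obtain t where t: "0 < t" "t < K" "W t \<omega> = 0" using \<open>0 < K\<close> by auto
    have "\<forall>\<^sub>F j in sequentially. 1 / real (Suc j) < t"
      using order_tendstoD(2)[OF LIMSEQ_Suc[OF lim_1_over_n] t(1)] .
    then show ?case
    proof eventually_elim
      case (elim j)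
      then show ?case
        using t entersI[OF \<open>cadlag_path (path \<omega>)\<close>, of "1 / real (Suc j)" t K]
        by (simp add: returns_def)
    qed
  qed
qed measurable

text \<open>Dominated convergence on each path, with the integrand over the whole half-line as the
  majorant, integrable because the total integral is finite.\<close>

lemma prob_initial_integral_tendsto:
  assumes [measurable]: "g \<in> borel_measurable borel"
    and fin: "AE \<omega> in M. sample_integral g {0..} (sample \<omega>) < \<infinity>" and "0 < \<eta>"
  shows "(\<lambda>i. prob {\<omega> \<in> space M. \<eta> < sample_integral g {0..1 / real (Suc i)} (sample \<omega>)}) \<longlonglongrightarrow> 0"
proof (rule prob_tendsto_zero)
  show "AE \<omega> in M. \<forall>\<^sub>F i in sequentially. \<not> \<eta> < sample_integral g {0..1 / real (Suc i)} (sample \<omega>)"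
    using fin
  proof eventually_elim
    case (elim \<omega>)
    define f where "f t = ennreal (g (right_value (sample \<omega>) t))" for t
    have [measurable]: "f \<in> borel_measurable borel" unfolding f_def by measurable
    have "(\<lambda>i. \<integral>\<^sup>+ t. f t * indicator {0..1 / real (Suc i)} t \<partial>lborel) \<longlonglongrightarrow> (\<integral>\<^sup>+ t. 0 \<partial>(lborel :: real measure))"
    proof (rule nn_integral_dominated_convergence[where w = "\<lambda>t. f t * indicator {0..} t"])
      show "(\<integral>\<^sup>+ t. f t * indicator {0..} t \<partial>lborel) < \<infinity>"
        using elim by (simp add: sample_integral_def f_def)
      show "AE t in lborel. f t * indicator {0..1 / real (Suc i)} t \<le> f t * indicator {0..} t" for i
        by (auto simp: indicator_def)
      \<comment> \<open>The point \<open>t = 0\<close> stays in every interval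
        \<open>{0..1 / real (Suc i)}\<close>; it is a null set.\<close>
      have conv: "(\<lambda>i. f t * indicator {0..1 / real (Suc i)} t) \<longlonglongrightarrow> 0" if "t \<noteq> 0" for t
      proof (cases "0 < t")
        case True
        have "\<forall>\<^sub>F i in sequentially. 1 / real (Suc i) < t"
          using order_tendstoD(2)[OF LIMSEQ_Suc[OF lim_1_over_n] True] .
        then show ?thesis by (intro tendsto_eventually, elim eventually_mono) (simp add: indicator_def)
      qed (use that in simp)
      show "AE t in lborel. (\<lambda>i. f t * indicator {0..1 / real (Suc i)} t) \<longlonglongrightarrow> 0"
        using AE_lborel_singleton[of "0 :: real"] by eventually_elim (rule conv)
    qed auto
    then have "(\<lambda>i. sample_integral g {0..1 / real (Suc i)} (sample \<omega>)) \<longlonglongrightarrow> 0"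
      by (simp add: sample_integral_def f_def)
    from order_tendstoD(2)[OF this \<open>0 < \<eta>\<close>] show ?case
      by (rule eventually_mono) simp
  qed
qed measurable

theorem sample_integral_no_atom:
  assumes g [measurable]: "g \<in> borel_measurable borel"
    and g_pos: "open U" "0 \<in> U" "\<And>x. x \<in> U \<Longrightarrow> 0 < g x"
    and regular: "AE \<omega> in M. \<forall>K>0. \<exists>t>0. t < K \<and> W t \<omega> = 0"
    and fin: "AE \<omega> in M. sample_integral g {0..} (sample \<omega>) < \<infinity>" and c: "c < \<infinity>"
  shows "AE \<omega> in M. sample_integral g {0..} (sample \<omega>) \<noteq> c"
proof -
  let ?p = "prob {\<omega> \<in> space M. sample_integral g {0..} (sample \<omega>) = c}"
  let ?q = "\<lambda>\<eta>. prob {\<omega> \<in> space M. sample_integral g {0..} (sample \<omega>) < c \<and>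
    c \<le> \<eta> + sample_integral g {0..} (sample \<omega>)}"
  \<comment> \<open>\<open>?q \<eta>\<close> depends on neither \<open>\<delta>\<close> nor
    \<open>K\<close>, because the law of the restarted integral is the same for all of them; so both
    limits can be taken with \<open>\<eta>\<close> fixed.\<close>
  have 1: "?p \<le> prob {\<omega> \<in> space M. \<eta> < sample_integral g {0..K} (sample \<omega>)} + ?q \<eta>" if "0 < K" for K \<eta>
  proof (rule LIMSEQ_le_const)
    show "(\<lambda>j. prob {\<omega> \<in> space M. \<not> returns (1 / real (Suc j)) K \<omega>} +
        (prob {\<omega> \<in> space M. \<eta> < sample_integral g {0..K} (sample \<omega>)} + ?q \<eta>)) \<longlonglongrightarrow>
        prob {\<omega> \<in> space M. \<eta> < sample_integral g {0..K} (sample \<omega>)} + ?q \<eta>"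
      using tendsto_add[OF prob_no_return_tendsto[OF regular that] tendsto_const] by simp
  qed (use prob_atom_le[OF g g_pos _ c] in auto)
  have 2: "?p \<le> ?q \<eta>" if "0 < \<eta>" for \<eta>
  proof (rule LIMSEQ_le_const)
    show "(\<lambda>i. prob {\<omega> \<in> space M. \<eta> < sample_integral g {0..1 / real (Suc i)} (sample \<omega>)} + ?q \<eta>) \<longlonglongrightarrow> ?q \<eta>"
      using tendsto_add[OF prob_initial_integral_tendsto[OF g fin that] tendsto_const] by simp
  qed (use 1 in auto)
  have "?p \<le> 0"
  proof (rule LIMSEQ_le_const)
    \<comment> \<open>The events shrink to the empty one: a value \<open>y < c\<close> still
      satisfies \<open>\<eta> + y < c\<close> once \<open>\<eta>\<close> is small.\<close>
    show "(\<lambda>l. ?q (ennreal (1 / real (Suc l)))) \<longlonglongrightarrow> 0"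
    proof (rule prob_tendsto_zero)
      have "\<forall>\<^sub>F l in sequentially. \<not> (y < c \<and> c \<le> ennreal (1 / real (Suc l)) + y)" for y
      proof (cases "y < c")
        case True
        have "(\<lambda>l. ennreal (1 / real (Suc l)) + y) \<longlonglongrightarrow> ennreal 0 + y"
          by (intro tendsto_add tendsto_const tendsto_ennrealI LIMSEQ_Suc[OF lim_1_over_n])
        from order_tendstoD(2)[OF this, of c] True
        have "\<forall>\<^sub>F l in sequentially. ennreal (1 / real (Suc l)) + y < c" by simp
        then show ?thesis by eventually_elim (simp add: not_le)
      qed simp
      then show "AE \<omega> in M. \<forall>\<^sub>F l in sequentially. \<not> (sample_integral g {0..} (sample \<omega>) < c \<and>
          c \<le> ennreal (1 / real (Suc l)) + sample_integral g {0..} (sample \<omega>))"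
        by simp
    qed measurable
  qed (use 2 in auto)
  then have "?p = 0" using measure_nonneg[of M] by (intro antisym) auto
  then show ?thesis
    by (subst (asm) prob_eq_0) auto
qed

end

section \<open>Reduction to a process starting at 0 everywhere\<close>

lemma based_levy_process_diff:
  assumes levy: "levy_process M X"
  shows "based_levy_process M (\<lambda>t \<omega>. X t \<omega> - X 0 \<omega>)"
proof -
  interpret prob_space M using levy by (simp add: levy_process_def)
  have meas: "X t \<in> borel_measurable M" if "0 \<le> t" for t
    using levy that by (simp add: levy_process_def)
  have X0: "AE \<omega> in M. X 0 \<omega> = 0" using levy by (simp add: levy_process_def)
  \<comment> \<open>Subtracting \<open>X 0\<close> changes each variable on a null set only, so the
    one-dimensional laws are kept; increments do not change at all.\<close>
  have "distr M borel (\<lambda>\<omega>. X t \<omega> - X 0 \<omega>) = distr M borel (X t)" if "0 \<le> t" for t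
    by (rule distr_cong_AE) (use X0 meas[OF that] meas[of 0] in auto)
  moreover have "AE \<omega> in M. cadlag_path (\<lambda>t. X t \<omega> - X 0 \<omega>)"
  proof -
    have "AE \<omega> in M. cadlag_path (\<lambda>t. X t \<omega>)" using levy by (simp add: levy_process_def)
    then show ?thesis using X0 by eventually_elim simp
  qed
  ultimately have "levy_process M (\<lambda>t \<omega>. X t \<omega> - X 0 \<omega>)"
    using levy borel_measurable_diff[OF meas meas[of 0]] by (simp add: levy_process_def)
  then show ?thesis
    by unfold_locales auto
qed

theorem theorem3p6:
  fixes M :: "'a measure" and X :: "real \<Rightarrow> 'a \<Rightarrow> real" and g :: "real \<Rightarrow> real"
  assumes g_meas: "g \<in> borel_measurable borel"
    and g_nonneg: "\<And>x. g x \<ge> 0"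
    and g_pos: "\<exists>U. open U \<and> 0 \<in> U \<and> (\<forall>x\<in>U. g x > 0)"
    and levy: "levy_process M X"
    and nonzero: "\<not> (\<forall>t\<ge>0. AE \<omega> in M. X t \<omega> = 0)"
    and transient: "transient_process M X"
    and regular: "zero_regular_for_itself M X"
    and finite: "AE \<omega> in M. perpetual_integral g X \<omega> < \<infinity>"
  shows "\<forall>x::real. AE \<omega> in M. perpetual_integral g X \<omega> \<noteq> ennreal x"
proof
  fix x :: real
  have X0: "AE \<omega> in M. X 0 \<omega> = 0" using levy by (simp add: levy_process_def)
  interpret based_levy_process M "\<lambda>t \<omega>. X t \<omega> - X 0 \<omega>"
    by (rule based_levy_process_diff[OF levy])
  from g_pos obtain U where U: "open U" "0 \<in> U" "\<And>x. x \<in> U \<Longrightarrow> 0 < g x" by auto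
  have eq: "AE \<omega> in M. sample_integral g {0..} (sample \<omega>) = perpetual_integral g X \<omega>"
    using X0 AE_cadlag
  proof eventually_elim
    case (elim \<omega>)
    then show ?case
      unfolding sample_integral_def perpetual_integral_def
      by (intro nn_integral_cong) (simp add: right_value_sample indicator_def)
  qed
  \<comment> \<open>An infimum equal to 0 over strictly positive zeros forces a zero below every
    \<open>K > 0\<close>.\<close>
  have "AE \<omega> in M. \<forall>K>0. \<exists>t>0. t < K \<and> X t \<omega> - X 0 \<omega> = 0"
    using regular[unfolded zero_regular_for_itself_def] X0
  proof eventually_elim
    case (elim \<omega>)
    show ?case
    proof (intro allI impI)
      fix K :: real assume "0 < K"
      then have "Inf (ereal ` {t. t > 0 \<and> X t \<omega> = 0}) < ereal K" using elim by simp
      then obtain t where "0 < t" "X t \<omega> = 0" "t < K" unfolding Inf_less_iff by auto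
      then show "\<exists>t>0. t < K \<and> X t \<omega> - X 0 \<omega> = 0" using elim by auto
    qed
  qed
  moreover have "AE \<omega> in M. sample_integral g {0..} (sample \<omega>) < \<infinity>"
    using eq finite by eventually_elim simp
  \<comment> \<open>\<open>ennreal x\<close> is finite for every real \<open>x\<close>, with value 0
    for negative \<open>x\<close>; the value \<open>\<infinity>\<close> is excluded almost surely by
    \<open>finite\<close>.\<close>
  ultimately have "AE \<omega> in M. sample_integral g {0..} (sample \<omega>) \<noteq> ennreal x"
    by (intro sample_integral_no_atom[OF g_meas U]) auto
  then show "AE \<omega> in M. perpetual_integral g X \<omega> \<noteq> ennreal x"
    using eq by eventually_elim simp
qed

end
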